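(* Let $X_1,\dots,X_k$ be non-trivial connected vertex-transitive graphs with arc-types $\tau_1,\dots,\tau_k$, respectively. Then the Cartesian product $X=X_1\,\square\,\cdots\,\square\,X_k$ is a connected vertex-transitive graph, and if $X_1,\dots,X_k$ are pairwise relatively prime (with respect to the Cartesian product), then the arc-type of $X$ is $\tau_1+\dots+\tau_k$.
   Context: All graphs are finite, simple and undirected; non-trivial means having at least one edge. An arc of a graph $X$ is an ordered pair $(u,v)$ of adjacent vertices. $X$ is vertex-transitive if $\mathrm{Aut}(X)$ is transitive on the vertices of $X$. Cartesian product: $X\,\square\,Y$ has vertex set $V(X)\times V(Y)$, with $(u,x)$ and $(v,y)$ adjacent if and only if either $u=v$ and $x,y$ are adjacent in $Y$, or $x=y$ and $u,v$ are adjacent in $X$. This extends (associatively) to products $X_1\,\square\,\cdots\,\square\,X_k$, whose terms are called factors. Two graphs are relatively prime if there is no non-trivial graph that is (up to isomorphism) a factor of both. Marked partition: a marked partition of a positive integer $d$ is an expression $d = n_1+\dots+n_t+(m_1+m_1)+\dots+(m_s+m_s)$ with $t,s\ge 0$ and all $n_i,m_j$ positive integers; formally, a pair consisting of a multiset $\{n_1,\dots,n_t\}$ (unbracketed summands) and a multiset $\{m_1,\dots,m_s\}$ (bracketed pairs). The order of the summands is irrelevant. The sum of marked partitions is obtained by concatenating them (multiset union of the unbracketed summands and multiset union of the bracketed pairs). Arc-type: let $X$ be a connected vertex-transitive graph of valency $d$, let $A=\mathrm{Aut}(X)$, and let $A(v)$ be the set of arcs of $X$ starting at a vertex $v$. For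 an orbit $\Delta$ of $A$ on arcs, its paired orbit is $\Delta^*=\{(w,u):(u,w)\in\Delta\}$; $\Delta$ is self-paired if $\Delta=\Delta^*$. Write the orbits of $A$ on arcs as $\Delta_1,\dots,\Delta_t$ (self-paired) and $\Delta_{t+1},\Delta_{t+1}^*,\dots,\Delta_{t+s},\Delta_{t+s}^*$ (non-self-paired, in pairs). Put $n_i=|A(v)\cap\Delta_i|$ for $1\le i\le t$ and $m_j=|A(v)\cap\Delta_{t+j}|=|A(v)\cap\Delta_{t+j}^*|$ for $1\le j\le s$; these do not depend on $v$. The arc-type of $X$ is the marked partition $n_1+\dots+n_t+(m_1+m_1)+\dots+(m_s+m_s)$ of $d$. *)

theory Defs
  imports
    "Graph_Theory.Pair_Digraph"
    "Graph_Theory.Digraph_Component"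
    "Graph_Theory.Digraph_Isomorphism"
    "HOL-Library.Multiset"
    "HOL-Library.FuncSet"
    "HOL-Library.Product_Plus"
begin

text \<open>
  A finite simple undirected graph is a \<^locale>\<open>pair_graph\<close>: a finite loop-free digraph without
  parallel arcs whose arc relation is symmetric. Its arcs \<^const>\<open>parcs\<close> are thus the
  ordered pairs of adjacent vertices. The library's \<^const>\<open>connected\<close> requires at
  least one vertex.
\<close>

definition nontrivial :: "'a pair_pre_digraph \<Rightarrow> bool" where
  "nontrivial G \<longleftrightarrow> parcs G \<noteq> {}"


subsection \<open>Isomorphisms and vertex-transitivity\<close>

definition graph_isomorphism ::
    "('a \<Rightarrow> 'b) \<Rightarrow> 'a pair_pre_digraph \<Rightarrow> 'b pair_pre_digraph \<Rightarrow> bool" where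
  "graph_isomorphism f G H \<longleftrightarrow> bij_betw f (pverts G) (pverts H) \<and>
     (\<forall>u\<in>pverts G. \<forall>v\<in>pverts G. (u, v) \<in> parcs G \<longleftrightarrow> (f u, f v) \<in> parcs H)"

text \<open>
  The values of an automorphism outside the vertex set are unconstrained; only its
  action on vertices and arcs is used.
\<close>

definition Aut :: "'a pair_pre_digraph \<Rightarrow> ('a \<Rightarrow> 'a) set" where
  "Aut G = {f. graph_isomorphism f G G}"

definition vertex_transitive :: "'a pair_pre_digraph \<Rightarrow> bool" where
  "vertex_transitive G \<longleftrightarrow> (\<forall>u\<in>pverts G. \<forall>v\<in>pverts G. \<exists>f\<in>Aut G. f u = v)"


subsection \<open>Cartesian products\<close>

definition box_product ::
    "'a pair_pre_digraph \<Rightarrow> 'b pair_pre_digraph \<Rightarrow> ('a \<times> 'b) pair_pre_digraph"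
    (infixr \<open>\<box>\<close> 70) where
  "G \<box> H = \<lparr> pverts = pverts G \<times> pverts H,
     parcs = {((u, x), (v, y)) | u x v y.
       u \<in> pverts G \<and> v \<in> pverts G \<and> x \<in> pverts H \<and> y \<in> pverts H \<and>
       (u = v \<and> (x, y) \<in> parcs H \<or> x = y \<and> (u, v) \<in> parcs G)} \<rparr>"

text \<open>
  The product of a family \<open>X\<^sub>i\<close> for \<open>i \<in> I\<close>. Iterating the binary product would change the
  vertex type at each step, so the vertices are the choice functions on \<open>I\<close>; lemmas
  \<open>cart_prod_singleton\<close> and \<open>cart_prod_insert\<close> below show that this is the iterated
  binary product.
\<close>

definition cart_prod :: "'i set \<Rightarrow> ('i \<Rightarrow> 'a pair_pre_digraph) \<Rightarrow> ('i \<Rightarrow> 'a) pair_pre_digraph" where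
  "cart_prod I X = \<lparr> pverts = (\<Pi>\<^sub>E i\<in>I. pverts (X i)),
     parcs = {(f, g). f \<in> (\<Pi>\<^sub>E i\<in>I. pverts (X i)) \<and> g \<in> (\<Pi>\<^sub>E i\<in>I. pverts (X i)) \<and>
       (\<exists>i\<in>I. (f i, g i) \<in> parcs (X i) \<and> (\<forall>j\<in>I - {i}. f j = g j))} \<rparr>"

text \<open>
  Every finite graph is isomorphic to one on natural numbers, so quantifying
  over graphs of type \<^typ>\<open>nat pair_pre_digraph\<close> loses no graphs; see
  \<open>is_factorI\<close> and \<open>not_relatively_primeI\<close>.
\<close>

definition is_factor :: "'a pair_pre_digraph \<Rightarrow> 'b pair_pre_digraph \<Rightarrow> bool" where
  "is_factor Z G \<longleftrightarrow> (\<exists>Y :: nat pair_pre_digraph. pair_graph Y \<and> digraph_iso G (Z \<box> Y))"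

definition relatively_prime :: "'a pair_pre_digraph \<Rightarrow> 'b pair_pre_digraph \<Rightarrow> bool" where
  "relatively_prime G H \<longleftrightarrow>
     \<not> (\<exists>Z :: nat pair_pre_digraph. pair_graph Z \<and> nontrivial Z \<and> is_factor Z G \<and> is_factor Z H)"


subsection \<open>Arc-types\<close>

text \<open>
  A marked partition is the pair of the multiset of its unbracketed summands and the multiset with
  one entry \<open>m\<close> for each bracketed pair \<open>(m + m)\<close>. Addition on pairs is componentwise.
\<close>

type_synonym marked_partition = "nat multiset \<times> nat multiset"

definition arc_orbits :: "'a pair_pre_digraph \<Rightarrow> 'a rel set" where
  "arc_orbits G = {{(f u, f v) | f. f \<in> Aut G} | u v. (u, v) \<in> parcs G}"

text \<open>
  The orbit paired with \<open>\<Delta>\<close> is \<open>\<Delta>\<inverse>\<close>. The set \<open>R\<close> picks one orbit from each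
  pair \<open>{\<Delta>, \<Delta>\<inverse>}\<close> of orbits that are not self-paired. By \<open>ex1_has_arc_type\<close> below,
  the result depends neither on \<open>R\<close> nor on the vertex.
\<close>

definition has_arc_type :: "'a pair_pre_digraph \<Rightarrow> marked_partition \<Rightarrow> bool" where
  "has_arc_type G \<tau> \<longleftrightarrow>
     (\<exists>R. R \<subseteq> {\<Delta> \<in> arc_orbits G. \<Delta>\<inverse> \<noteq> \<Delta>} \<and>
       (\<forall>\<Delta>\<in>arc_orbits G. \<Delta>\<inverse> \<noteq> \<Delta> \<longrightarrow> (\<Delta> \<in> R \<longleftrightarrow> \<Delta>\<inverse> \<notin> R)) \<and>
       (\<forall>v\<in>pverts G. \<tau> =
         ({# card (out_arcs G v \<inter> \<Delta>). \<Delta> \<in># mset_set {\<Delta> \<in> arc_orbits G. \<Delta>\<inverse> = \<Delta>} #},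
          {# card (out_arcs G v \<inter> \<Delta>). \<Delta> \<in># mset_set R #})))"


subsection \<open>Consistency of the definitions\<close>

lemma digraph_iso_iff:
  assumes "pair_wf_digraph G" "pair_wf_digraph H"
  shows "digraph_iso (with_proj G) (with_proj H) \<longleftrightarrow> (\<exists>f. graph_isomorphism f G H)"
proof
  interpret G: pair_wf_digraph G by fact
  assume "digraph_iso (with_proj G) (with_proj H)"
  then obtain h where h: "G.digraph_isomorphism h" and H: "with_proj H = app_iso h (with_proj G)"
    unfolding digraph_iso_def by auto
  have V: "pverts H = iso_verts h ` pverts G" using arg_cong[OF H, of verts] by simp
  have A: "parcs H = iso_arcs h ` parcs G" using arg_cong[OF H, of arcs] by simp
  have T: "iso_tail h = fst" using arg_cong[OF H, of tail] by simp
  have S: "iso_head h = snd" using arg_cong[OF H, of head] by simp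
  have inj: "inj_on (iso_verts h) (pverts G)"
    using h unfolding G.digraph_isomorphism_def by simp
  have arc: "iso_arcs h a = (iso_verts h (fst a), iso_verts h (snd a))" if "a \<in> parcs G" for a
    using h that unfolding G.digraph_isomorphism_def T S by (simp add: prod_eq_iff)
  have "graph_isomorphism (iso_verts h) G H"
    unfolding graph_isomorphism_def
  proof (intro conjI ballI)
    show "bij_betw (iso_verts h) (pverts G) (pverts H)" using inj V by (simp add: bij_betw_def)
    fix u v assume uv: "u \<in> pverts G" "v \<in> pverts G"
    show "(u, v) \<in> parcs G \<longleftrightarrow> (iso_verts h u, iso_verts h v) \<in> parcs H"
    proof
      assume "(u, v) \<in> parcs G" then show "(iso_verts h u, iso_verts h v) \<in> parcs H"
        using arc A by force
    next
      assume "(iso_verts h u, iso_verts h v) \<in> parcs H"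
      then obtain a where a: "a \<in> parcs G" "iso_arcs h a = (iso_verts h u, iso_verts h v)"
        using A by auto
      have "fst a = u" "snd a = v"
        using a arc[OF a(1)] uv inj G.arc_fst_in_verts[OF a(1)] G.arc_snd_in_verts[OF a(1)]
        by (auto dest: inj_onD)
      then show "(u, v) \<in> parcs G" using a by (metis prod.collapse)
    qed
  qed
  then show "\<exists>f. graph_isomorphism f G H" by (rule exI[of "\<lambda>f. graph_isomorphism f G H"])
next
  interpret G: pair_wf_digraph G by fact
  interpret H: pair_wf_digraph H by fact
  assume "\<exists>f. graph_isomorphism f G H"
  then obtain f where f: "bij_betw f (pverts G) (pverts H)"
    and fa: "\<And>u v. u \<in> pverts G \<Longrightarrow> v \<in> pverts G \<Longrightarrow> (u, v) \<in> parcs G \<longleftrightarrow> (f u, f v) \<in> parcs H"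
    unfolding graph_isomorphism_def by blast
  define h where "h = \<lparr> iso_verts = f, iso_arcs = map_prod f f,
    iso_head = snd :: 'b \<times> 'b \<Rightarrow> 'b, iso_tail = fst :: 'b \<times> 'b \<Rightarrow> 'b \<rparr>"
  have inj: "inj_on f (pverts G)" and surj: "f ` pverts G = pverts H"
    using f by (auto simp: bij_betw_def)
  have "inj_on (map_prod f f) (parcs G)"
    by (rule inj_on_subset[OF map_prod_inj_on[OF inj inj]])
      (auto dest: G.in_arcsD1 G.in_arcsD2)
  then have "G.digraph_isomorphism h"
    using inj G.wf_digraph unfolding G.digraph_isomorphism_def h_def by simp
  moreover have "map_prod f f ` parcs G = parcs H"
  proof
    show "map_prod f f ` parcs G \<subseteq> parcs H"
      using fa by (auto dest: G.in_arcsD1 G.in_arcsD2)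
    show "parcs H \<subseteq> map_prod f f ` parcs G"
    proof
      fix a assume a: "a \<in> parcs H"
      obtain x y where xy: "a = (x, y)" by fastforce
      with a have "x \<in> f ` pverts G" "y \<in> f ` pverts G"
        using H.in_arcsD1 H.in_arcsD2 surj by blast+
      then obtain u v where "u \<in> pverts G" "v \<in> pverts G" "x = f u" "y = f v" by blast
      then show "a \<in> map_prod f f ` parcs G" using fa[of u v] a xy by force
    qed
  qed
  then have "with_proj H = app_iso h (with_proj G)"
    unfolding app_iso_def h_def with_proj_def using surj by simp
  ultimately show "digraph_iso (with_proj G) (with_proj H)"
    unfolding digraph_iso_def by blast
qed

lemma graph_isomorphism_comp:
  assumes "graph_isomorphism f G H" "graph_isomorphism g H K"
  shows "graph_isomorphism (g \<circ> f) G K"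
proof -
  have "f u \<in> pverts H" if "u \<in> pverts G" for u
    using assms(1) that unfolding graph_isomorphism_def bij_betw_def by blast
  then show ?thesis
    using assms unfolding graph_isomorphism_def by (auto intro: bij_betw_trans)
qed

lemma graph_isomorphism_inv:
  assumes "graph_isomorphism f G H"
  shows "graph_isomorphism (inv_into (pverts G) f) H G"
proof -
  have f: "bij_betw f (pverts G) (pverts H)"
    using assms by (simp add: graph_isomorphism_def)
  have "inv_into (pverts G) f x \<in> pverts G \<and> f (inv_into (pverts G) f x) = x"
    if "x \<in> pverts H" for x
    using f that by (metis bij_betw_imp_surj_on f_inv_into_f inv_into_into)
  then show ?thesis
    using assms bij_betw_inv_into[OF f] unfolding graph_isomorphism_def by auto
qed

lemma pair_graph_iff:
  "pair_graph G \<longleftrightarrow> finite (pverts G) \<and> parcs G \<subseteq> pverts G \<times> pverts G \<and>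
     irrefl (parcs G) \<and> sym (parcs G)"
proof
  assume "pair_graph G"
  then interpret pair_graph G .
  show "finite (pverts G) \<and> parcs G \<subseteq> pverts G \<times> pverts G \<and>
     irrefl (parcs G) \<and> sym (parcs G)"
    using pair_finite_verts pair_sym_arcs
    by (auto simp: irrefl_def symmetric_def dest: in_arcsD1 in_arcsD2 pair_no_loops)
next
  assume G: "finite (pverts G) \<and> parcs G \<subseteq> pverts G \<times> pverts G \<and>
     irrefl (parcs G) \<and> sym (parcs G)"
  then have "finite (parcs G)" by (meson finite_SigmaI finite_subset)
  then show "pair_graph G"
    using G by unfold_locales (auto simp: irrefl_def symmetric_def)
qed

lemma pair_graph_box_product:
  assumes "pair_graph G" "pair_graph H"
  shows "pair_graph (G \<box> H)"
  using assms unfolding pair_graph_iff box_product_def irrefl_def sym_def by auto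

lemma pair_graph_cart_prod:
  assumes "finite I" "\<And>i. i \<in> I \<Longrightarrow> pair_graph (X i)"
  shows "pair_graph (cart_prod I X)"
  unfolding pair_graph_iff
proof (intro conjI)
  have X: "finite (pverts (X i))" "irrefl (parcs (X i))" "sym (parcs (X i))" if "i \<in> I" for i
    using assms(2)[OF that] by (auto simp: pair_graph_iff)
  show "finite (pverts (cart_prod I X))"
    using assms(1) X(1) by (simp add: cart_prod_def finite_PiE)
  show "irrefl (parcs (cart_prod I X))"
    using X(2) by (auto simp: cart_prod_def irrefl_def)
  show "sym (parcs (cart_prod I X))"
  proof (rule symI)
    fix f g assume "(f, g) \<in> parcs (cart_prod I X)"
    then obtain i where i: "i \<in> I" "(f i, g i) \<in> parcs (X i)" "\<forall>j\<in>I - {i}. f j = g j"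
      and fg: "f \<in> (\<Pi>\<^sub>E i\<in>I. pverts (X i))" "g \<in> (\<Pi>\<^sub>E i\<in>I. pverts (X i))"
      by (auto simp: cart_prod_def)
    have "(g i, f i) \<in> parcs (X i)" "\<forall>j\<in>I - {i}. g j = f j"
      using X(3)[OF i(1)] i by (auto dest: symD)
    then show "(g, f) \<in> parcs (cart_prod I X)"
      unfolding cart_prod_def using i(1) fg by auto
  qed
qed (auto simp: cart_prod_def)

lemma cart_prod_singleton:
  assumes "pair_graph (X i)"
  shows "graph_isomorphism (\<lambda>f. f i) (cart_prod {i} X) (X i)"
proof -
  have "bij_betw (\<lambda>f. f i) (\<Pi>\<^sub>E j\<in>{i}. pverts (X j)) (pverts (X i))"
    by (rule bij_betwI[where g = "\<lambda>x. restrict (\<lambda>_. x) {i}"]) (auto simp: PiE_iff extensional_def)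
  then show ?thesis
    unfolding graph_isomorphism_def cart_prod_def by auto
qed

lemma cart_prod_insert:
  assumes "i \<notin> I" "pair_graph (X i)" "\<And>j. j \<in> I \<Longrightarrow> pair_graph (X j)"
  shows "graph_isomorphism (\<lambda>f. (restrict f I, f i))
    (cart_prod (insert i I) X) (cart_prod I X \<box> X i)"
proof -
  let ?P = "\<Pi>\<^sub>E j\<in>insert i I. pverts (X j)" and ?Q = "\<Pi>\<^sub>E j\<in>I. pverts (X j)"
  have bij: "bij_betw (\<lambda>f. (restrict f I, f i)) ?P (?Q \<times> pverts (X i))"
    by (rule bij_betwI[where g = "\<lambda>(f, x). f(i := x)"])
      (use assms(1) in \<open>auto simp: PiE_iff extensional_def fun_eq_iff split: if_splits\<close>)
  have irr: "(x, x) \<notin> parcs (X j)" if "j \<in> insert i I" for j x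
    using assms that by (auto simp: pair_graph_iff irrefl_def)
  have "(f, g) \<in> parcs (cart_prod (insert i I) X) \<longleftrightarrow>
      ((restrict f I, f i), (restrict g I, g i)) \<in> parcs (cart_prod I X \<box> X i)"
    if f: "f \<in> ?P" and g: "g \<in> ?P" for f g
  proof -
    have r: "restrict f I \<in> ?Q" "restrict g I \<in> ?Q" "f i \<in> pverts (X i)" "g i \<in> pverts (X i)"
      using f g by auto
    have e: "restrict f I = restrict g I \<longleftrightarrow> (\<forall>j\<in>I. f j = g j)"
      by (metis restrict_apply' restrict_ext)
    have ne: "j \<noteq> i" if "j \<in> I" for j using that assms(1) by blast
    have 1: "(f, g) \<in> parcs (cart_prod (insert i I) X) \<longleftrightarrow>
      (\<exists>j\<in>insert i I. (f j, g j) \<in> parcs (X j) \<and> (\<forall>l\<in>insert i I - {j}. f l = g l))"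
      using f g by (simp add: cart_prod_def)
    have 2: "((restrict f I, f i), (restrict g I, g i)) \<in> parcs (cart_prod I X \<box> X i) \<longleftrightarrow>
      (\<forall>j\<in>I. f j = g j) \<and> (f i, g i) \<in> parcs (X i) \<or>
      f i = g i \<and> (\<exists>j\<in>I. (f j, g j) \<in> parcs (X j) \<and> (\<forall>l\<in>I - {j}. f l = g l))"
      using r e by (simp add: cart_prod_def box_product_def)
    show ?thesis unfolding 1 2 using ne by auto
  qed
  then show ?thesis
    using bij unfolding graph_isomorphism_def by (simp add: cart_prod_def box_product_def)
qed

lemma nat_copy:
  assumes "pair_graph G"
  obtains H :: "nat pair_pre_digraph" and f where "pair_graph H" "graph_isomorphism f G H"
proof -
  have G: "finite (pverts G)" "parcs G \<subseteq> pverts G \<times> pverts G" "irrefl (parcs G)" "sym (parcs G)"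
    using assms by (auto simp: pair_graph_iff)
  from G(1) obtain f :: "'a \<Rightarrow> nat" where f: "inj_on f (pverts G)"
    using finite_imp_inj_to_nat_seg[OF G(1)] by metis
  define H where "H = \<lparr> pverts = f ` pverts G, parcs = map_prod f f ` parcs G \<rparr>"
  have mem: "(f u, f v) \<in> map_prod f f ` parcs G \<longleftrightarrow> (u, v) \<in> parcs G"
    if "u \<in> pverts G" "v \<in> pverts G" for u v
  proof
    assume "(f u, f v) \<in> map_prod f f ` parcs G"
    then obtain x y where xy: "(x, y) \<in> parcs G" "f x = f u" "f y = f v" by fastforce
    then have "x = u" "y = v" using G(2) f that by (auto dest: inj_onD)
    then show "(u, v) \<in> parcs G" using xy by simp
  qed force
  have "graph_isomorphism f G H"
    using f mem by (simp add: graph_isomorphism_def H_def bij_betw_def)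
  moreover have "pair_graph H"
    unfolding pair_graph_iff
  proof (intro conjI)
    show "irrefl (parcs H)"
      using G(2,3) f by (auto simp: H_def irrefl_def dest: inj_onD)
    show "sym (parcs H)"
      using G(4) by (force simp: H_def sym_def)
  qed (use G in \<open>auto simp: H_def\<close>)
  ultimately show ?thesis using that by blast
qed

lemma box_product_isomorphism:
  assumes "graph_isomorphism f G G'" "graph_isomorphism g H H'"
  shows "graph_isomorphism (map_prod f g) (G \<box> H) (G' \<box> H')"
proof -
  have f: "bij_betw f (pverts G) (pverts G')" and g: "bij_betw g (pverts H) (pverts H')"
    using assms by (auto simp: graph_isomorphism_def)
  have "f u = f v \<longleftrightarrow> u = v" if "u \<in> pverts G" "v \<in> pverts G" for u v
    using f that by (auto simp: bij_betw_def dest: inj_onD)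
  moreover have "g u = g v \<longleftrightarrow> u = v" if "u \<in> pverts H" "v \<in> pverts H" for u v
    using g that by (auto simp: bij_betw_def dest: inj_onD)
  moreover have "f u \<in> pverts G'" if "u \<in> pverts G" for u
    using f that by (auto simp: bij_betw_def)
  moreover have "g u \<in> pverts H'" if "u \<in> pverts H" for u
    using g that by (auto simp: bij_betw_def)
  ultimately show ?thesis
    using assms bij_betw_map_prod[OF f g]
    unfolding graph_isomorphism_def box_product_def by auto
qed

lemma pair_graph_imp_wf: "pair_graph G \<Longrightarrow> pair_wf_digraph G"
  by (simp add: pair_graph_def pair_digraph_def pair_fin_digraph_def)

lemma is_factor_iff:
  assumes "pair_graph G" "pair_graph Z"
  shows "is_factor Z G \<longleftrightarrow>
    (\<exists>(Y :: nat pair_pre_digraph) f. pair_graph Y \<and> graph_isomorphism f G (Z \<box> Y))"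
proof -
  have "digraph_iso (with_proj G) (with_proj (Z \<box> Y)) \<longleftrightarrow> (\<exists>f. graph_isomorphism f G (Z \<box> Y))"
    if "pair_graph Y" for Y :: "nat pair_pre_digraph"
    using assms that by (intro digraph_iso_iff pair_graph_imp_wf pair_graph_box_product)
  then show ?thesis unfolding is_factor_def by blast
qed

lemma is_factorI:
  assumes "pair_graph G" "pair_graph Z" "pair_graph Y"
    and "digraph_iso (with_proj G) (with_proj (Z \<box> Y))"
  shows "is_factor Z G"
proof -
  have "\<exists>f. graph_isomorphism f G (Z \<box> Y)"
    using assms(4) unfolding digraph_iso_iff[OF pair_graph_imp_wf[OF assms(1)]
      pair_graph_imp_wf[OF pair_graph_box_product[OF assms(2,3)]]] .
  then obtain f where f: "graph_isomorphism f G (Z \<box> Y)" by (rule exE)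
  obtain Y' :: "nat pair_pre_digraph" and g where Y': "pair_graph Y'" "graph_isomorphism g Y Y'"
    by (rule nat_copy[OF assms(3)])
  have "graph_isomorphism id Z Z" by (simp add: graph_isomorphism_def)
  then have "graph_isomorphism (map_prod id g) (Z \<box> Y) (Z \<box> Y')"
    using Y'(2) by (rule box_product_isomorphism)
  then have "graph_isomorphism (map_prod id g \<circ> f) G (Z \<box> Y')"
    by (rule graph_isomorphism_comp[OF f])
  then show ?thesis
    using Y'(1) unfolding is_factor_iff[OF assms(1,2)] by blast
qed

lemma is_factor_iso:
  assumes "pair_graph G" "pair_graph Z" "pair_graph Z'" "graph_isomorphism f Z Z'" "is_factor Z G"
  shows "is_factor Z' G"
proof -
  obtain Y :: "nat pair_pre_digraph" and g where Y: "pair_graph Y" "graph_isomorphism g G (Z \<box> Y)"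
    using assms(1,2,5) by (auto simp: is_factor_iff)
  have "graph_isomorphism id Y Y" by (simp add: graph_isomorphism_def)
  then have "graph_isomorphism (map_prod f id) (Z \<box> Y) (Z' \<box> Y)"
    by (rule box_product_isomorphism[OF assms(4)])
  then have "graph_isomorphism (map_prod f id \<circ> g) G (Z' \<box> Y)"
    by (rule graph_isomorphism_comp[OF Y(2)])
  then show ?thesis
    using Y(1) unfolding is_factor_iff[OF assms(1,3)] by blast
qed

lemma not_relatively_primeI:
  assumes "pair_graph G" "pair_graph H" "pair_graph Z" "nontrivial Z" "is_factor Z G" "is_factor Z H"
  shows "\<not> relatively_prime G H"
proof -
  obtain Z' :: "nat pair_pre_digraph" and f where Z': "pair_graph Z'" "graph_isomorphism f Z Z'"
    by (rule nat_copy[OF assms(3)])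
  obtain u v where uv: "(u, v) \<in> parcs Z" using assms(4) by (auto simp: nontrivial_def)
  then have "u \<in> pverts Z" "v \<in> pverts Z" using assms(3) by (auto simp: pair_graph_iff)
  then have "(f u, f v) \<in> parcs Z'"
    using uv Z'(2) by (simp add: graph_isomorphism_def)
  then have "nontrivial Z'" by (auto simp: nontrivial_def)
  moreover have "is_factor Z' G" by (rule is_factor_iso[OF assms(1,3) Z' assms(5)])
  moreover have "is_factor Z' H" by (rule is_factor_iso[OF assms(2,3) Z' assms(6)])
  ultimately show ?thesis
    unfolding relatively_prime_def using Z'(1) by blast
qed

lemma arc_orbits_finite:
  assumes "pair_graph G"
  shows "finite (arc_orbits G)" "\<Delta> \<in> arc_orbits G \<Longrightarrow> \<Delta> \<subseteq> parcs G"
proof -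
  have G: "finite (pverts G)" "parcs G \<subseteq> pverts G \<times> pverts G"
    using assms by (auto simp: pair_graph_iff)
  show sub: "\<Delta> \<subseteq> parcs G" if "\<Delta> \<in> arc_orbits G" for \<Delta>
    using that G(2) by (auto simp: arc_orbits_def Aut_def graph_isomorphism_def)
  have "finite (parcs G)" using G by (meson finite_SigmaI finite_subset)
  then show "finite (arc_orbits G)"
    using sub by (intro finite_subset[of "arc_orbits G" "Pow (parcs G)"]) auto
qed

lemma arc_orbits_image:
  assumes "\<Delta> \<in> arc_orbits G" "f \<in> Aut G" "(x, y) \<in> \<Delta>"
  shows "(f x, f y) \<in> \<Delta>"
proof -
  obtain u v where D: "\<Delta> = {(g u, g v) | g. g \<in> Aut G}"
    using assms(1) by (auto simp: arc_orbits_def)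
  then obtain g where g: "g \<in> Aut G" "x = g u" "y = g v" using assms(3) by auto
  have "f \<circ> g \<in> Aut G"
    using assms(2) g(1) graph_isomorphism_comp by (auto simp: Aut_def)
  moreover have "(f x, f y) = ((f \<circ> g) u, (f \<circ> g) v)" using g by simp
  ultimately show ?thesis unfolding D by blast
qed

lemma arc_orbits_converse:
  assumes "pair_graph G" "\<Delta> \<in> arc_orbits G"
  shows "\<Delta>\<inverse> \<in> arc_orbits G"
proof -
  obtain u v where D: "(u, v) \<in> parcs G" "\<Delta> = {(g u, g v) | g. g \<in> Aut G}"
    using assms(2) by (auto simp: arc_orbits_def)
  have "(v, u) \<in> parcs G" using assms(1) D(1) by (auto simp: pair_graph_iff dest: symD)
  moreover have "\<Delta>\<inverse> = {(g v, g u) | g. g \<in> Aut G}" using D(2) by auto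
  ultimately show ?thesis unfolding arc_orbits_def by blast
qed

lemma card_out_orbit:
  assumes "pair_graph G" "vertex_transitive G" "\<Delta> \<in> arc_orbits G" "v \<in> pverts G" "w \<in> pverts G"
  shows "card (out_arcs G v \<inter> \<Delta>) = card (out_arcs G w \<inter> \<Delta>)"
proof -
  have le: "card (out_arcs G v \<inter> \<Delta>) \<le> card (out_arcs G w \<inter> \<Delta>)"
    if v: "v \<in> pverts G" and w: "w \<in> pverts G" for v w
  proof -
    obtain f where f: "f \<in> Aut G" "f v = w"
      using assms(2) v w unfolding vertex_transitive_def by blast
    have G: "finite (parcs G)" "parcs G \<subseteq> pverts G \<times> pverts G"
      using assms(1) by (auto simp: pair_graph_iff intro: finite_subset)
    have D: "\<Delta> \<subseteq> parcs G" using arc_orbits_finite assms(1,3) by blast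
    have inj: "inj_on f (pverts G)"
      using f(1) by (auto simp: Aut_def graph_isomorphism_def bij_betw_def)
    show ?thesis
    proof (rule card_inj_on_le[where f = "map_prod f f"])
      show "inj_on (map_prod f f) (out_arcs G v \<inter> \<Delta>)"
        by (rule inj_on_subset[OF map_prod_inj_on[OF inj inj]]) (use D G in auto)
      show "map_prod f f ` (out_arcs G v \<inter> \<Delta>) \<subseteq> out_arcs G w \<inter> \<Delta>"
        using f arc_orbits_image[OF assms(3) f(1)] D by (auto simp: out_arcs_def)
      show "finite (out_arcs G w \<inter> \<Delta>)" using D G finite_subset by blast
    qed
  qed
  show ?thesis using le assms(4,5) by (meson antisym)
qed

lemma card_out_orbit_converse:
  assumes "pair_graph G" "vertex_transitive G" "\<Delta> \<in> arc_orbits G" "v \<in> pverts G"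
  shows "card (out_arcs G v \<inter> \<Delta>\<inverse>) = card (out_arcs G v \<inter> \<Delta>)"
proof -
  have G: "finite (pverts G)" "finite (parcs G)" "parcs G \<subseteq> pverts G \<times> pverts G"
    using assms(1) by (auto simp: pair_graph_iff intro: finite_subset)
  have count: "card E = card (pverts G) * card (out_arcs G v \<inter> E)" if E: "E \<in> arc_orbits G" for E
  proof -
    have sub: "E \<subseteq> parcs G" using arc_orbits_finite assms(1) E by blast
    have "E = (\<Union>w\<in>pverts G. out_arcs G w \<inter> E)" using subsetD[OF sub] subsetD[OF G(3)] by (fastforce simp: out_arcs_def)
    also have "card \<dots> = (\<Sum>w\<in>pverts G. card (out_arcs G w \<inter> E))"
      using G(1) finite_subset[OF sub G(2)] by (intro card_UN_disjoint) (auto simp: out_arcs_def)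
    also have "\<dots> = (\<Sum>w\<in>pverts G. card (out_arcs G v \<inter> E))"
      using card_out_orbit[OF assms(1,2) E _ assms(4)] by simp
    finally show ?thesis by simp
  qed
  have "card (pverts G) > 0" using G(1) assms(4) by (auto simp: card_gt_0_iff)
  moreover have "card (pverts G) * card (out_arcs G v \<inter> \<Delta>\<inverse>) =
      card (pverts G) * card (out_arcs G v \<inter> \<Delta>)"
    using count[OF assms(3)] count[OF arc_orbits_converse[OF assms(1,3)]] card_inverse[of \<Delta>] by metis
  ultimately show ?thesis by simp
qed

lemma ex1_has_arc_type:
  assumes G: "pair_graph G" and vt: "vertex_transitive G" and ne: "pverts G \<noteq> {}"
  shows "\<exists>!\<tau>. has_arc_type G \<tau>"
proof -
  define N where "N = {\<Delta> \<in> arc_orbits G. \<Delta>\<inverse> \<noteq> \<Delta>}"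
  define rep where "rep R \<longleftrightarrow> R \<subseteq> N \<and> (\<forall>\<Delta>\<in>arc_orbits G. \<Delta>\<inverse> \<noteq> \<Delta> \<longrightarrow> (\<Delta> \<in> R \<longleftrightarrow> \<Delta>\<inverse> \<notin> R))" for R
  define T where "T v R =
    ({# card (out_arcs G v \<inter> \<Delta>). \<Delta> \<in># mset_set {\<Delta> \<in> arc_orbits G. \<Delta>\<inverse> = \<Delta>} #},
     {# card (out_arcs G v \<inter> \<Delta>). \<Delta> \<in># mset_set R #})" for v R
  have has: "has_arc_type G \<tau> \<longleftrightarrow> (\<exists>R. rep R \<and> (\<forall>v\<in>pverts G. \<tau> = T v R))" for \<tau>
    unfolding has_arc_type_def rep_def N_def T_def by (simp add: conj_assoc)
  have fin: "finite (arc_orbits G)" using arc_orbits_finite[OF G] by blast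
  have finR: "finite R" if "rep R" for R
    using that fin unfolding rep_def N_def by (auto intro: finite_subset)
  have conv: "\<Delta>\<inverse> \<in> N" if "\<Delta> \<in> N" for \<Delta>
    using that arc_orbits_converse[OF G] by (auto simp: N_def)
  have indep: "T v R = T w R" if v: "v \<in> pverts G" "w \<in> pverts G" and R: "rep R" for v w R
  proof -
    have "card (out_arcs G v \<inter> \<Delta>) = card (out_arcs G w \<inter> \<Delta>)" if "\<Delta> \<in> arc_orbits G" for \<Delta>
      by (rule card_out_orbit[OF G vt that v])
    then show ?thesis
      using R fin finR[OF R] unfolding T_def rep_def N_def
      by (auto intro!: image_mset_cong)
  qed
  have same: "T v R = T v S" if v: "v \<in> pverts G" and R: "rep R" and S: "rep S" for v R S
  proof -
    define g where "g \<Delta> = (if \<Delta> \<in> S then \<Delta> else \<Delta>\<inverse>)" for \<Delta> :: "'a rel"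
    have RN: "R \<subseteq> N" and SN: "S \<subseteq> N" using R S by (auto simp: rep_def)
    have R1: "\<Delta> \<in> R \<longleftrightarrow> \<Delta>\<inverse> \<notin> R" and S1: "\<Delta> \<in> S \<longleftrightarrow> \<Delta>\<inverse> \<notin> S" if "\<Delta> \<in> N" for \<Delta>
      using R S that unfolding rep_def N_def by blast+
    have inj: "inj_on g R"
    proof (rule inj_onI)
      fix D E assume DE: "D \<in> R" "E \<in> R" "g D = g E"
      have "E \<noteq> D\<inverse>" using R1[of D] DE RN by blast
      then have "D\<inverse> \<noteq> E" "D \<noteq> E\<inverse>" by auto
      then show "D = E" using DE(3) by (auto simp: g_def split: if_splits)
    qed
    have img: "g ` R = S"
    proof
      show "g ` R \<subseteq> S" using S1 RN by (auto simp: g_def)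
      show "S \<subseteq> g ` R"
      proof
        fix D assume D: "D \<in> S"
        then have "D \<in> N" using SN by blast
        show "D \<in> g ` R"
        proof (cases "D \<in> R")
          case True
          show ?thesis by (rule image_eqI[OF _ True]) (simp add: g_def D)
        next
          case False
          then have "D\<inverse> \<in> R" "D\<inverse> \<notin> S" using R1[OF \<open>D \<in> N\<close>] S1[OF \<open>D \<in> N\<close>] D by auto
          then show ?thesis by (intro image_eqI[of _ _ "D\<inverse>"]) (auto simp: g_def)
        qed
      qed
    qed
    have "{# card (out_arcs G v \<inter> \<Delta>). \<Delta> \<in># mset_set S #} =
        {# card (out_arcs G v \<inter> g \<Delta>). \<Delta> \<in># mset_set R #}"
      unfolding img[symmetric] image_mset_mset_set[OF inj, symmetric]
      by (simp add: image_mset.compositionality comp_def)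
    also have "\<dots> = {# card (out_arcs G v \<inter> \<Delta>). \<Delta> \<in># mset_set R #}"
      using RN finR[OF R] card_out_orbit_converse[OF G vt _ v]
      by (intro image_mset_cong) (auto simp: g_def N_def)
    finally show ?thesis by (simp add: T_def)
  qed
  define c where "c \<Delta> = (SOME E. E \<in> {\<Delta>, \<Delta>\<inverse>})" for \<Delta> :: "'a rel"
  have c1: "c \<Delta> \<in> {\<Delta>, \<Delta>\<inverse>}" for \<Delta> unfolding c_def by (rule someI[of _ \<Delta>]) simp
  have c2: "c (\<Delta>\<inverse>) = c \<Delta>" for \<Delta> by (simp add: c_def insert_commute)
  have rep0: "rep {\<Delta> \<in> N. c \<Delta> = \<Delta>}"
    unfolding rep_def
  proof (intro conjI ballI impI)
    fix \<Delta> assume "\<Delta> \<in> arc_orbits G" and n: "\<Delta>\<inverse> \<noteq> \<Delta>"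
    then have "\<Delta> \<in> N" by (simp add: N_def)
    then show "\<Delta> \<in> {\<Delta> \<in> N. c \<Delta> = \<Delta>} \<longleftrightarrow> \<Delta>\<inverse> \<notin> {\<Delta> \<in> N. c \<Delta> = \<Delta>}"
      using conv[of \<Delta>] c1[of \<Delta>] c2[of \<Delta>] n by auto
  qed simp
  obtain v where v: "v \<in> pverts G" using ne by blast
  show ?thesis
  proof (rule ex1I[of _ "T v {\<Delta> \<in> N. c \<Delta> = \<Delta>}"])
    show "has_arc_type G (T v {\<Delta> \<in> N. c \<Delta> = \<Delta>})"
      using has rep0 indep[OF v _ rep0] by blast
    fix \<tau> assume "has_arc_type G \<tau>"
    then obtain R where "rep R" "\<tau> = T v R" unfolding has using v by blast
    then show "\<tau> = T v {\<Delta> \<in> N. c \<Delta> = \<Delta>}"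
      using same[OF v _ rep0] by simp
  qed
qed

end

theory Submission
  imports Defs
begin

text \<open>
  Connectedness and vertex-transitivity pass to the product because walks and automorphisms can be
  taken coordinate by coordinate. The content lies in the arc-type: one must see that no automorphism
  \<open>\<phi>\<close> of the product turns an arc of direction \<open>i\<close> (one that changes coordinate \<open>i\<close>) into an arc of
  another direction \<open>j\<close>.

  The argument is the one behind the uniqueness of prime factorizations, applied without factoring
  anything into primes. In a Cartesian product the distance is the sum of the distances of the
  coordinates (\<open>gdist_P\<close>). Hence changing one coordinate of \<open>x\<close> to that of \<open>y\<close> gives a vertex
  between \<open>x\<close> and \<open>y\<close>, and a geodesically convex vertex set is a box, that is, a product of subsets
  of the factors (\<open>geodesically_convex_eq_box\<close>). The \<open>i\<close>-layer through a vertex \<open>a\<close>, where only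
  coordinate \<open>i\<close> varies, is a convex copy of \<open>X i\<close>. Its image under \<open>\<phi>\<close> is therefore a box, and the
  intersection of this box with the \<open>j\<close>-layer through \<open>\<phi> a\<close> is one of the sides of the box, so it
  induces a factor of \<open>X i\<close>. Applying the inverse of \<open>\<phi>\<close> to the same intersection shows in the same
  way that it induces a factor of \<open>X j\<close>. If \<open>X i\<close> and \<open>X j\<close> are relatively prime, the intersection
  thus contains no arc (\<open>no_arc_in_crossing_layers\<close>). But if \<open>\<phi>\<close> mapped an arc of direction \<open>i\<close>
  starting at \<open>a\<close> to an arc of direction \<open>j\<close>, both ends of the image would lie in that intersection.

  So \<open>\<phi>\<close> maps layers to layers of the same direction, and on each layer it acts as an automorphism of
  the factor (\<open>Aut_factor\<close>). Conversely, automorphisms of the factors can be combined freely, and as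
  every factor is vertex-transitive, an arc orbit \<open>\<Delta>\<close> of \<open>X i\<close> yields a single arc orbit of the
  product, consisting of all arcs of direction \<open>i\<close> whose \<open>i\<close>-th coordinates form an arc in \<open>\<Delta>\<close>. This
  is a bijection from the disjoint union of the orbit sets of the factors onto the orbits of the
  product (\<open>arc_orbits_P\<close>, \<open>inj_on_arcs_along\<close>). It commutes with pairing of orbits and preserves the
  number of arcs at a vertex, so the arc-types add up.
\<close>

section \<open>Distance in a connected graph\<close>

definition connected_graph :: "'a pair_pre_digraph \<Rightarrow> bool" where
  "connected_graph G \<longleftrightarrow> pverts G \<noteq> {} \<and> (\<forall>u\<in>pverts G. \<forall>v\<in>pverts G. (u, v) \<in> (parcs G)\<^sup>*)"

text \<open>
  Arcs of a graph come in both directions, so directed reachability already is the connectedness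
  of the underlying undirected graph.
\<close>

lemma connected_iff:
  assumes "pair_graph G"
  shows "connected (with_proj G) \<longleftrightarrow> connected_graph G"
proof -
  have G: "parcs G \<subseteq> pverts G \<times> pverts G" "sym (parcs G)"
    using assms by (auto simp: pair_graph_iff)
  have parcs: "parcs (mk_symmetric (with_proj G)) = parcs G"
    using G(2) by (fastforce simp: parcs_mk_symmetric dest: symD)
  have "(u, v) \<in> rtrancl_on (pverts G) (parcs G) \<longleftrightarrow> (u, v) \<in> (parcs G)\<^sup>*"
    if u: "u \<in> pverts G" for u v
  proof
    assume "(u, v) \<in> rtrancl_on (pverts G) (parcs G)"
    then show "(u, v) \<in> (parcs G)\<^sup>*"
      by (induct rule: rtrancl_on_induct) (auto intro: rtrancl_into_rtrancl)
  next
    assume "(u, v) \<in> (parcs G)\<^sup>*"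
    then show "(u, v) \<in> rtrancl_on (pverts G) (parcs G)"
      by (induct rule: rtrancl_induct) (use u G(1) in \<open>auto intro: rtrancl_on_into_rtrancl_on\<close>)
  qed
  then show ?thesis
    by (simp add: connected_def strongly_connected_def reachable_def parcs connected_graph_def)
qed

text \<open>
  Only distances between vertices joined by a walk are meaningful; for others the value is that of
  \<^const>\<open>Least\<close> on an empty predicate.
\<close>

definition gdist :: "'a pair_pre_digraph \<Rightarrow> 'a \<Rightarrow> 'a \<Rightarrow> nat" where
  "gdist G u v = (LEAST n. (u, v) \<in> parcs G ^^ n)"

lemma gdist_le: "(u, v) \<in> parcs G ^^ n \<Longrightarrow> gdist G u v \<le> n"
  unfolding gdist_def by (rule Least_le)

lemma gdist_self [simp]: "gdist G u u = 0"
  using gdist_le[where v = u and n = 0] by simp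

lemma relpow_gdist:
  assumes "connected_graph G" "u \<in> pverts G" "v \<in> pverts G"
  shows "(u, v) \<in> parcs G ^^ gdist G u v"
proof -
  have "(u, v) \<in> (parcs G)\<^sup>*" using assms by (simp add: connected_graph_def)
  then obtain n where "(u, v) \<in> parcs G ^^ n" using rtrancl_imp_relpow by blast
  then show ?thesis unfolding gdist_def by (rule LeastI)
qed

lemma gdist_eq_0_iff:
  assumes "connected_graph G" "u \<in> pverts G" "v \<in> pverts G"
  shows "gdist G u v = 0 \<longleftrightarrow> u = v"
  using relpow_gdist[OF assms] by auto

lemma gdist_arc_le:
  assumes "connected_graph G" "(u, v) \<in> parcs G" "v \<in> pverts G" "w \<in> pverts G"
  shows "gdist G u w \<le> Suc (gdist G v w)"
  using relpow_Suc_I2[OF assms(2) relpow_gdist[OF assms(1,3,4)]] by (rule gdist_le)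

lemma gdist_triangle:
  assumes "connected_graph G" "u \<in> pverts G" "v \<in> pverts G" "w \<in> pverts G"
  shows "gdist G u w \<le> gdist G u v + gdist G v w"
  using relpow_gdist[OF assms(1,2,3)] relpow_gdist[OF assms(1,3,4)]
  by (intro gdist_le) (auto simp: relpow_add)

text \<open>
  The first arc of a shortest walk brings the target nearer by exactly one: by at least one since the
  rest of the walk is that short, and by at most one by the triangle inequality.
\<close>

lemma gdist_first_arc:
  assumes "pair_graph G" "connected_graph G" "u \<in> pverts G" "v \<in> pverts G" "u \<noteq> v"
  obtains w where "(u, w) \<in> parcs G" "w \<in> pverts G" "Suc (gdist G w v) = gdist G u v"
proof -
  obtain n where n: "gdist G u v = Suc n"
    using gdist_eq_0_iff[OF assms(2-4)] assms(5) by (cases "gdist G u v") auto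
  then obtain w where w: "(u, w) \<in> parcs G" "(w, v) \<in> parcs G ^^ n"
    using relpow_gdist[OF assms(2-4)] by (metis relpow_Suc_D2)
  have wV: "w \<in> pverts G" using w(1) assms(1) by (auto simp: pair_graph_iff)
  have "gdist G w v \<le> n" using w(2) by (rule gdist_le)
  moreover have "Suc n \<le> Suc (gdist G w v)"
    using gdist_arc_le[OF assms(2) w(1) wV assms(4)] n by simp
  ultimately show ?thesis using that[OF w(1) wV] n by simp
qed

lemma graph_isomorphism_relpow:
  assumes f: "graph_isomorphism f G H" and G: "pair_graph G" and u: "u \<in> pverts G"
    and "(u, v) \<in> parcs G ^^ n"
  shows "(f u, f v) \<in> parcs H ^^ n"
  using assms(4)
proof (induct n arbitrary: v)
  case (Suc n)
  then obtain w where w: "(u, w) \<in> parcs G ^^ n" "(w, v) \<in> parcs G" by auto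
  have "(f w, f v) \<in> parcs H"
    using w(2) f G by (auto simp: graph_isomorphism_def pair_graph_iff)
  then show ?case using Suc(1)[OF w(1)] by auto
qed simp

lemma gdist_isomorphism:
  assumes f: "graph_isomorphism f G H" and G: "pair_graph G" and H: "pair_graph H"
    and uv: "u \<in> pverts G" "v \<in> pverts G"
  shows "gdist H (f u) (f v) = gdist G u v"
proof -
  have f': "bij_betw f (pverts G) (pverts H)"
    using f by (simp add: graph_isomorphism_def)
  have inv: "inv_into (pverts G) f (f w) = w" if "w \<in> pverts G" for w
    using f' that by (simp add: bij_betw_inv_into_left)
  have "(f u, f v) \<in> parcs H ^^ n \<longleftrightarrow> (u, v) \<in> parcs G ^^ n" for n
    using graph_isomorphism_relpow[OF f G uv(1), of v n]
      graph_isomorphism_relpow[OF graph_isomorphism_inv[OF f] H, of "f u" "f v" n]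
      inv[OF uv(1)] inv[OF uv(2)] bij_betwE[OF f'] uv by metis
  then show ?thesis by (simp add: gdist_def)
qed


section \<open>Convex vertex sets and induced subgraphs\<close>

text \<open>
  The sum condition says that \<open>z\<close> lies on a shortest walk from \<open>x\<close> to \<open>y\<close>. Stating it by distances
  makes the notion invariant under isomorphisms without any reference to walks.
\<close>

definition geodesically_convex :: "'a pair_pre_digraph \<Rightarrow> 'a set \<Rightarrow> bool" where
  "geodesically_convex G W \<longleftrightarrow> W \<subseteq> pverts G \<and>
     (\<forall>x\<in>W. \<forall>y\<in>W. \<forall>z\<in>pverts G. gdist G x z + gdist G z y = gdist G x y \<longrightarrow> z \<in> W)"

lemma geodesically_convex_isomorphism:
  assumes f: "graph_isomorphism f G H" and G: "pair_graph G" and H: "pair_graph H"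
    and W: "geodesically_convex G W"
  shows "geodesically_convex H (f ` W)"
  unfolding geodesically_convex_def
proof (intro conjI ballI impI)
  have f': "f ` pverts G = pverts H"
    using f by (simp add: graph_isomorphism_def bij_betw_def)
  have WG: "W \<subseteq> pverts G" using W by (simp add: geodesically_convex_def)
  then show "f ` W \<subseteq> pverts H" using f' by blast
  fix x y z assume x: "x \<in> f ` W" and y: "y \<in> f ` W" and z: "z \<in> pverts H"
    and d: "gdist H x z + gdist H z y = gdist H x y"
  obtain u v w where uvw: "u \<in> W" "x = f u" "v \<in> W" "y = f v" "w \<in> pverts G" "z = f w"
    using x y z f' by blast
  have "gdist G u w + gdist G w v = gdist G u v"
    using d uvw WG gdist_isomorphism[OF f G H] by (metis subsetD)
  then have "w \<in> W" using W uvw unfolding geodesically_convex_def by blast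
  then show "z \<in> f ` W" using uvw by blast
qed

definition induced_on :: "'a pair_pre_digraph \<Rightarrow> 'a set \<Rightarrow> 'a pair_pre_digraph" where
  "induced_on G W = \<lparr> pverts = W, parcs = parcs G \<inter> W \<times> W \<rparr>"

lemma pair_graph_induced_on:
  assumes "pair_graph G" "W \<subseteq> pverts G"
  shows "pair_graph (induced_on G W)"
  using assms by (auto simp: pair_graph_iff induced_on_def irrefl_def sym_def intro: finite_subset)

lemma graph_isomorphism_induced_on:
  assumes "graph_isomorphism f G H" "W \<subseteq> pverts G"
  shows "graph_isomorphism f (induced_on G W) (induced_on H (f ` W))"
proof -
  have "inj_on f W"
    using assms inj_on_subset by (auto simp: graph_isomorphism_def bij_betw_def)
  then show ?thesis
    using assms by (auto simp: graph_isomorphism_def induced_on_def bij_betw_def)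
qed

lemma induced_on_pverts:
  assumes "pair_graph G"
  shows "induced_on G (pverts G) = G"
proof -
  have "parcs G \<inter> pverts G \<times> pverts G = parcs G"
    using assms by (auto simp: pair_graph_iff)
  then show ?thesis by (simp add: induced_on_def)
qed

lemma is_factor_isoI:
  assumes "pair_graph G" "pair_graph Z" "pair_graph Y" "graph_isomorphism f G (Z \<box> Y)"
  shows "is_factor Z G"
  using assms pair_graph_box_product[OF assms(2,3)]
  by (intro is_factorI[OF assms(1-3)]) (auto simp: digraph_iso_iff pair_graph_imp_wf)

lemma is_factor_iso_left:
  assumes G: "pair_graph G" and H: "pair_graph H" and Z: "pair_graph Z"
    and f: "graph_isomorphism f G H" and "is_factor Z H"
  shows "is_factor Z G"
proof -
  obtain Y :: "nat pair_pre_digraph" and g where Y: "pair_graph Y" "graph_isomorphism g H (Z \<box> Y)"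
    using assms(5) by (auto simp: is_factor_iff[OF H Z])
  show ?thesis by (rule is_factor_isoI[OF G Z Y(1) graph_isomorphism_comp[OF f Y(2)]])
qed

lemma box_product_commute:
  "graph_isomorphism prod.swap (G \<box> H) (H \<box> G)"
  unfolding graph_isomorphism_def
proof (intro conjI)
  show "bij_betw prod.swap (pverts (G \<box> H)) (pverts (H \<box> G))"
    by (auto simp: box_product_def bij_betw_def product_swap)
qed (auto simp: box_product_def)


section \<open>Products of connected graphs\<close>

locale connected_factors =
  fixes I :: "'i set" and X :: "'i \<Rightarrow> 'a pair_pre_digraph"
  assumes finite_I: "finite I"
    and factor: "\<And>i. i \<in> I \<Longrightarrow> pair_graph (X i)"
    and factor_connected: "\<And>i. i \<in> I \<Longrightarrow> connected_graph (X i)"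
begin

definition P where "P = cart_prod I X"

lemma pair_graph_P: "pair_graph P"
  unfolding P_def by (rule pair_graph_cart_prod[OF finite_I factor])

lemma arc_vertices: "i \<in> I \<Longrightarrow> (u, v) \<in> parcs (X i) \<Longrightarrow> u \<in> pverts (X i) \<and> v \<in> pverts (X i)"
  using factor[of i] by (auto simp: pair_graph_iff)

lemma pverts_P: "pverts P = (\<Pi>\<^sub>E i\<in>I. pverts (X i))"
  by (simp add: P_def cart_prod_def)

lemma coord: "x \<in> pverts P \<Longrightarrow> i \<in> I \<Longrightarrow> x i \<in> pverts (X i)"
  by (auto simp: pverts_P)

lemma upd_in: "x \<in> pverts P \<Longrightarrow> i \<in> I \<Longrightarrow> u \<in> pverts (X i) \<Longrightarrow> x(i := u) \<in> pverts P"
  by (auto simp: pverts_P PiE_iff extensional_def)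

lemma eq_upd:
  assumes "x \<in> pverts P" "y \<in> pverts P" "\<forall>j\<in>I - {i}. x j = y j"
  shows "y = x(i := y i)"
proof
  fix j show "y j = (x(i := y i)) j"
    using assms by (cases "j \<in> I") (auto simp: pverts_P PiE_iff extensional_def)
qed

text \<open>
  The function-update form of adjacency fits distances and layers better than the condition that all
  other coordinates agree.
\<close>

lemma arc_P_iff:
  "(x, y) \<in> parcs P \<longleftrightarrow> x \<in> pverts P \<and> (\<exists>i\<in>I. \<exists>u. (x i, u) \<in> parcs (X i) \<and> y = x(i := u))"
proof
  assume "(x, y) \<in> parcs P"
  then obtain i where i: "i \<in> I" "(x i, y i) \<in> parcs (X i)" "\<forall>j\<in>I - {i}. x j = y j"
    and xy: "x \<in> pverts P" "y \<in> pverts P"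
    by (auto simp: P_def cart_prod_def)
  then have "y = x(i := y i)" by (intro eq_upd)
  then show "x \<in> pverts P \<and> (\<exists>i\<in>I. \<exists>u. (x i, u) \<in> parcs (X i) \<and> y = x(i := u))"
    using i xy by blast
next
  assume "x \<in> pverts P \<and> (\<exists>i\<in>I. \<exists>u. (x i, u) \<in> parcs (X i) \<and> y = x(i := u))"
  then obtain i u where *: "x \<in> pverts P" "i \<in> I" "(x i, u) \<in> parcs (X i)" "y = x(i := u)"
    by blast
  then have "y \<in> pverts P" using arc_vertices upd_in by blast
  then show "(x, y) \<in> parcs P"
    using * unfolding P_def cart_prod_def by auto
qed

text \<open>
  Changing coordinate \<open>i\<close> affects only the \<open>i\<close>-th summand. The two sides are arranged so that no
  subtraction of natural numbers occurs.
\<close>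

lemma sum_gdist_upd:
  assumes "i \<in> I"
  shows "(\<Sum>j\<in>I. gdist (X j) ((x(i := u)) j) (y j)) + gdist (X i) (x i) (y i)
       = (\<Sum>j\<in>I. gdist (X j) (x j) (y j)) + gdist (X i) u (y i)"
  using finite_I assms by (simp add: sum.remove)

text \<open>
  Each arc of a walk changes one coordinate along one arc of a factor, so it lowers the sum of the
  coordinate distances to \<open>y\<close> by at most one.
\<close>

lemma sum_gdist_le_walk:
  assumes "y \<in> pverts P" "(x, y) \<in> parcs P ^^ n"
  shows "(\<Sum>i\<in>I. gdist (X i) (x i) (y i)) \<le> n"
  using assms(2)
proof (induct n arbitrary: x)
  case (Suc n)
  obtain z where z: "(x, z) \<in> parcs P" "(z, y) \<in> parcs P ^^ n"
    using relpow_Suc_D2[OF Suc(2)] by blast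
  obtain i u where iu: "i \<in> I" "(x i, u) \<in> parcs (X i)" "z = x(i := u)"
    using z(1) by (auto simp: arc_P_iff)
  have "gdist (X i) (x i) (y i) \<le> Suc (gdist (X i) u (y i))"
    using gdist_arc_le[OF factor_connected iu(2)] arc_vertices[OF iu(1,2)] coord[OF assms(1)] iu(1)
    by blast
  then show ?case
    using sum_gdist_upd[OF iu(1), of x u y] Suc(1)[OF z(2)] iu(3) by simp
qed simp

text \<open>
  As long as some coordinate differs from that of \<open>y\<close>, it can be moved one step nearer within its
  factor, which lowers the sum by one.
\<close>

lemma walk_of_sum_gdist:
  assumes "x \<in> pverts P" "y \<in> pverts P"
  shows "(x, y) \<in> parcs P ^^ (\<Sum>i\<in>I. gdist (X i) (x i) (y i))"
  using assms(1)
proof (induct "\<Sum>i\<in>I. gdist (X i) (x i) (y i)" arbitrary: x)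
  case 0
  have "x i = y i" if "i \<in> I" for i
    using 0(1) finite_I that gdist_eq_0_iff[OF factor_connected[OF that]] coord[OF _ that] 0(2) assms(2)
    by (metis sum_eq_0_iff)
  then have "x = y" using 0(2) assms(2) unfolding pverts_P by (metis PiE_ext)
  then show ?case by simp
next
  case (Suc n)
  have "\<exists>i\<in>I. x i \<noteq> y i"
  proof (rule ccontr)
    assume "\<not> ?thesis"
    then have "(\<Sum>i\<in>I. gdist (X i) (x i) (y i)) = 0" by simp
    then show False using Suc(2) by simp
  qed
  then obtain i where i: "i \<in> I" "x i \<noteq> y i" by blast
  obtain u where u: "(x i, u) \<in> parcs (X i)" "u \<in> pverts (X i)"
      "Suc (gdist (X i) u (y i)) = gdist (X i) (x i) (y i)"
    using gdist_first_arc[OF factor[OF i(1)] factor_connected[OF i(1)] _ _ i(2)]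
      coord[OF Suc(3) i(1)] coord[OF assms(2) i(1)] by blast
  let ?z = "x(i := u)"
  have n: "n = (\<Sum>j\<in>I. gdist (X j) (?z j) (y j))"
    using sum_gdist_upd[OF i(1), of x u y] u(3) Suc(2) by simp
  have "(x, ?z) \<in> parcs P" using Suc(3) i u by (auto simp: arc_P_iff)
  moreover have "(?z, y) \<in> parcs P ^^ n"
    using Suc(1)[OF n upd_in[OF Suc(3) i(1) u(2)]] n by simp
  ultimately have "(x, y) \<in> parcs P ^^ Suc n" by (rule relpow_Suc_I2)
  then show ?case using Suc(2) by simp
qed

lemma pverts_P_nonempty: "pverts P \<noteq> {}"
  using factor_connected by (auto simp: pverts_P PiE_eq_empty_iff connected_graph_def)

lemma connected_graph_P: "connected_graph P"
  unfolding connected_graph_def using pverts_P_nonempty walk_of_sum_gdist relpow_imp_rtrancl by blast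

lemma gdist_P:
  assumes "x \<in> pverts P" "y \<in> pverts P"
  shows "gdist P x y = (\<Sum>i\<in>I. gdist (X i) (x i) (y i))"
  using gdist_le[OF walk_of_sum_gdist[OF assms]]
    sum_gdist_le_walk[OF assms(2) relpow_gdist[OF connected_graph_P assms]] by (rule antisym)

lemma Aut_P_componentwise:
  assumes f: "\<And>i. i \<in> I \<Longrightarrow> f i \<in> Aut (X i)"
  shows "(\<lambda>x. \<lambda>i\<in>I. f i (x i)) \<in> Aut P"
proof -
  let ?F = "\<lambda>x. \<lambda>i\<in>I. f i (x i)"
  have bij: "bij_betw (f i) (pverts (X i)) (pverts (X i))" if "i \<in> I" for i
    using f[OF that] by (simp add: Aut_def graph_isomorphism_def)
  have eq: "f i (x i) = f i (y i) \<longleftrightarrow> x i = y i"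
    if "x \<in> pverts P" "y \<in> pverts P" "i \<in> I" for x y i
    using bij[OF that(3)] coord that by (metis bij_betw_imp_inj_on inj_on_eq_iff)
  have arc: "(f i (x i), f i (y i)) \<in> parcs (X i) \<longleftrightarrow> (x i, y i) \<in> parcs (X i)"
    if "x \<in> pverts P" "y \<in> pverts P" "i \<in> I" for x y i
    using f[OF that(3)] coord that by (simp add: Aut_def graph_isomorphism_def)
  have into: "?F x \<in> pverts P" if "x \<in> pverts P" for x
    using bij_betwE[OF bij] coord[OF that] by (auto simp: pverts_P)
  have "inj_on ?F (pverts P)"
  proof (rule inj_onI)
    fix x y assume x: "x \<in> pverts P" and y: "y \<in> pverts P" and F: "?F x = ?F y"
    have "x i = y i" if "i \<in> I" for i
      using fun_cong[OF F, of i] eq[OF x y that] that by simp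
    then show "x = y" using x y unfolding pverts_P by (metis PiE_ext)
  qed
  moreover have "?F ` pverts P = pverts P"
    using into calculation pair_graph_P by (intro endo_inj_surj) (auto simp: pair_graph_iff)
  moreover have "(x, y) \<in> parcs P \<longleftrightarrow> (?F x, ?F y) \<in> parcs P"
    if x: "x \<in> pverts P" and y: "y \<in> pverts P" for x y
  proof -
    have "(x, y) \<in> parcs P \<longleftrightarrow> (\<exists>i\<in>I. (x i, y i) \<in> parcs (X i) \<and> (\<forall>j\<in>I - {i}. x j = y j))"
      if "x \<in> pverts P" "y \<in> pverts P" for x y
      using that by (simp add: P_def cart_prod_def)
    from this[OF x y] this[OF into[OF x] into[OF y]] show ?thesis
      using eq[OF x y] arc[OF x y] by auto
  qed
  ultimately show ?thesis by (simp add: Aut_def graph_isomorphism_def bij_betw_def)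
qed

lemma vertex_transitive_P:
  assumes "\<And>i. i \<in> I \<Longrightarrow> vertex_transitive (X i)"
  shows "vertex_transitive P"
  unfolding vertex_transitive_def
proof (intro ballI)
  fix x y assume x: "x \<in> pverts P" and y: "y \<in> pverts P"
  have "\<forall>i\<in>I. \<exists>f. f \<in> Aut (X i) \<and> f (x i) = y i"
    using assms coord x y unfolding vertex_transitive_def by blast
  then obtain f where f: "\<forall>i\<in>I. f i \<in> Aut (X i) \<and> f i (x i) = y i" by metis
  show "\<exists>g\<in>Aut P. g x = y"
  proof (rule bexI)
    show "(\<lambda>i\<in>I. f i (x i)) = y"
    proof
      fix j show "(\<lambda>i\<in>I. f i (x i)) j = y j"
        using f y by (cases "j \<in> I") (auto simp: pverts_P PiE_iff extensional_def)
    qed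
    show "(\<lambda>x. \<lambda>i\<in>I. f i (x i)) \<in> Aut P" using f by (intro Aut_P_componentwise) blast
  qed
qed


section \<open>Convex sets of a product are boxes\<close>

text \<open>
  The distance from \<open>x\<close> to \<open>y\<close> splits into the part of coordinate \<open>i\<close>, which is the distance from
  \<open>x\<close> to \<open>x(i := y i)\<close>, and the rest, which is the distance from there to \<open>y\<close>.
\<close>

lemma geodesically_convex_exchange:
  assumes W: "geodesically_convex P W" and xy: "x \<in> W" "y \<in> W" and i: "i \<in> I"
  shows "x(i := y i) \<in> W"
proof -
  have V: "x \<in> pverts P" "y \<in> pverts P" using W xy unfolding geodesically_convex_def by blast+
  let ?z = "x(i := y i)"
  have z: "?z \<in> pverts P" by (rule upd_in[OF V(1) i coord[OF V(2) i]])
  have "gdist P x ?z = (\<Sum>j\<in>I. if j = i then gdist (X i) (x i) (y i) else 0)"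
    unfolding gdist_P[OF V(1) z] by (rule sum.cong[OF refl]) simp
  then have "gdist P x ?z = gdist (X i) (x i) (y i)"
    using finite_I i by simp
  moreover have "gdist P ?z y + gdist (X i) (x i) (y i) = gdist P x y"
    using sum_gdist_upd[OF i, of x "y i" y] unfolding gdist_P[OF z V(2)] gdist_P[OF V] by (simp only: gdist_self add_0_right)
  ultimately have "gdist P x ?z + gdist P ?z y = gdist P x y" by linarith
  then show ?thesis using W xy z unfolding geodesically_convex_def by blast
qed

text \<open>
  A vertex whose coordinates all occur in \<open>W\<close> is reached from \<open>a\<close> by exchanging one coordinate after
  the other.
\<close>

lemma geodesically_convex_eq_box:
  assumes W: "geodesically_convex P W" and a: "a \<in> W"
  shows "W = (\<Pi>\<^sub>E i\<in>I. (\<lambda>x. x i) ` W)"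
proof
  have WV: "W \<subseteq> pverts P" using W by (simp add: geodesically_convex_def)
  show "W \<subseteq> (\<Pi>\<^sub>E i\<in>I. (\<lambda>x. x i) ` W)"
  proof
    fix x assume x: "x \<in> W"
    then have "x \<in> extensional I" using WV by (auto simp: pverts_P PiE_iff)
    then show "x \<in> (\<Pi>\<^sub>E i\<in>I. (\<lambda>x. x i) ` W)" using x by (simp add: PiE_iff)
  qed
  show "(\<Pi>\<^sub>E i\<in>I. (\<lambda>x. x i) ` W) \<subseteq> W"
  proof
    fix y assume y: "y \<in> (\<Pi>\<^sub>E i\<in>I. (\<lambda>x. x i) ` W)"
    have "override_on a y J \<in> W" if "finite J" "J \<subseteq> I" for J
      using that
    proof (induct J rule: finite_induct)
      case empty
      then show ?case using a by simp
    next
      case (insert i J)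
      then have "y i \<in> (\<lambda>x. x i) ` W" by (intro PiE_mem[OF y]) simp
      then obtain w where w: "w \<in> W" "y i = w i" by blast
      have "override_on a y (insert i J) = (override_on a y J)(i := w i)"
        using w(2) by (auto simp: override_on_def)
      moreover have "(override_on a y J)(i := w i) \<in> W"
        using insert by (intro geodesically_convex_exchange[OF W _ w(1)]) simp_all
      ultimately show ?case by (simp only:)
    qed
    then have "override_on a y I \<in> W" using finite_I by simp
    moreover have "override_on a y I = y"
    proof
      fix j
      have "a \<in> extensional I" "y \<in> extensional I"
        using a WV y by (auto simp: pverts_P PiE_iff)
      then show "override_on a y I j = y j" by (cases "j \<in> I") (auto simp: extensional_def)
    qed
    ultimately show "y \<in> W" by simp
  qed
qed

definition layer where "layer i a = {x \<in> pverts P. \<forall>j\<in>I - {i}. x j = a j}"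

lemma layer_trans: "x \<in> layer i y \<Longrightarrow> y \<in> layer i z \<Longrightarrow> x \<in> layer i z"
  by (simp add: layer_def)

text \<open>
  If a vertex lies between two members of a layer, then equality holds in the triangle
  inequality in every coordinate. In a coordinate on which the two members agree this forces
  the same value.
\<close>

lemma geodesically_convex_layer: "geodesically_convex P (layer i a)"
  unfolding geodesically_convex_def
proof (intro conjI ballI impI)
  fix x y z assume xy: "x \<in> layer i a" "y \<in> layer i a" and z: "z \<in> pverts P"
    and d: "gdist P x z + gdist P z y = gdist P x y"
  have V: "x \<in> pverts P" "y \<in> pverts P" using xy by (auto simp: layer_def)
  show "z \<in> layer i a" unfolding layer_def
  proof (intro CollectI conjI ballI z)
    fix j assume j: "j \<in> I - {i}"
    have "gdist (X j) (x j) (y j) = gdist (X j) (x j) (z j) + gdist (X j) (z j) (y j)"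
    proof (rule sum_mono_inv[where f = "\<lambda>l. gdist (X l) (x l) (y l)"
          and g = "\<lambda>l. gdist (X l) (x l) (z l) + gdist (X l) (z l) (y l)"])
      show "(\<Sum>l\<in>I. gdist (X l) (x l) (y l)) = (\<Sum>l\<in>I. gdist (X l) (x l) (z l) + gdist (X l) (z l) (y l))"
        using d by (simp add: gdist_P V z sum.distrib)
      show "gdist (X l) (x l) (y l) \<le> gdist (X l) (x l) (z l) + gdist (X l) (z l) (y l)"
        if "l \<in> I" for l
        using gdist_triangle[OF factor_connected] coord V z that by blast
    qed (use j finite_I in auto)
    moreover have "x j = a j" "y j = a j" using xy j by (auto simp: layer_def)
    ultimately have "gdist (X j) (x j) (z j) = 0" by simp
    then show "z j = a j"
      using gdist_eq_0_iff[OF factor_connected coord[OF V(1)] coord[OF z], of j] j \<open>x j = a j\<close> by auto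
  qed
qed (auto simp: layer_def)

text \<open>
  Moving coordinate \<open>i\<close> alone cannot produce an arc of another direction \<open>j\<close>, since that would be a
  loop in \<open>X j\<close>.
\<close>

lemma arc_fibre_iff:
  assumes "a \<in> pverts P" "i \<in> I" "u \<in> pverts (X i)"
  shows "(a(i := u), a(i := v)) \<in> parcs P \<longleftrightarrow> (u, v) \<in> parcs (X i)"
proof
  assume "(a(i := u), a(i := v)) \<in> parcs P"
  then obtain j w where j: "j \<in> I" "((a(i := u)) j, w) \<in> parcs (X j)"
    and e: "a(i := v) = a(i := u, j := w)" unfolding arc_P_iff by blast
  have "j = i"
  proof (rule ccontr)
    assume "j \<noteq> i"
    then have "(w, w) \<in> parcs (X j)" using j(2) arg_cong[OF e, of "\<lambda>f. f j"] by simp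
    then show False using factor[OF j(1)] by (auto simp: pair_graph_iff irrefl_def)
  qed
  then show "(u, v) \<in> parcs (X i)" using j(2) arg_cong[OF e, of "\<lambda>f. f i"] by simp
next
  assume "(u, v) \<in> parcs (X i)"
  then show "(a(i := u), a(i := v)) \<in> parcs P"
    unfolding arc_P_iff
    by (intro conjI bexI[of _ i] exI[of _ v]) (simp_all add: upd_in[OF assms] assms(2))
qed

lemma fibre_isomorphism:
  assumes "a \<in> pverts P" "i \<in> I" "U \<subseteq> pverts (X i)"
  shows "graph_isomorphism (\<lambda>u. a(i := u)) (induced_on (X i) U) (induced_on P ((\<lambda>u. a(i := u)) ` U))"
proof -
  have "inj_on (\<lambda>u. a(i := u)) U" by (auto intro!: inj_onI dest: fun_upd_eqD)
  then show ?thesis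
    using arc_fibre_iff[OF assms(1,2)] assms(3)
    by (auto simp: graph_isomorphism_def induced_on_def bij_betw_def)
qed

lemma layer_eq_fibre:
  assumes "a \<in> pverts P" "i \<in> I"
  shows "layer i a = (\<lambda>u. a(i := u)) ` pverts (X i)"
proof
  show "layer i a \<subseteq> (\<lambda>u. a(i := u)) ` pverts (X i)"
  proof
    fix x assume "x \<in> layer i a"
    then have x: "x \<in> pverts P" "\<forall>j\<in>I - {i}. a j = x j" by (auto simp: layer_def)
    show "x \<in> (\<lambda>u. a(i := u)) ` pverts (X i)"
      using eq_upd[OF assms(1) x] coord[OF x(1) assms(2)] by blast
  qed
qed (use upd_in[OF assms] in \<open>auto simp: layer_def split: if_splits\<close>)

lemma layer_isomorphic_factor:
  assumes "a \<in> pverts P" "i \<in> I"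
  obtains g where "graph_isomorphism g (X i) (induced_on P (layer i a))"
  using that fibre_isomorphism[OF assms order_refl]
  unfolding induced_on_pverts[OF factor[OF assms(2)]] layer_eq_fibre[OF assms, symmetric] .

text \<open>
  A box induces the Cartesian product of its sides, and splitting off the coordinate \<open>i\<close> exhibits
  the \<open>i\<close>-th side as a factor.
\<close>

lemma is_factor_of_box:
  assumes U: "\<And>j. j \<in> I \<Longrightarrow> U j \<subseteq> pverts (X j)" and i: "i \<in> I"
  shows "is_factor (induced_on (X i) (U i)) (induced_on P (\<Pi>\<^sub>E j\<in>I. U j))"
proof -
  let ?Y = "\<lambda>j. induced_on (X j) (U j)"
  have Y: "pair_graph (?Y j)" if "j \<in> I" for j
    by (rule pair_graph_induced_on[OF factor[OF that] U[OF that]])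
  have UV: "(\<Pi>\<^sub>E j\<in>I. U j) \<subseteq> pverts P" unfolding pverts_P using U by (rule PiE_mono)
  have "parcs P \<inter> (\<Pi>\<^sub>E j\<in>I. U j) \<times> (\<Pi>\<^sub>E j\<in>I. U j) = parcs (cart_prod I ?Y)"
    (is "?L = ?R")
  proof (rule set_eqI, clarify)
    fix x y
    have "(x, y) \<in> ?L \<longleftrightarrow> x \<in> (\<Pi>\<^sub>E j\<in>I. U j) \<and> y \<in> (\<Pi>\<^sub>E j\<in>I. U j) \<and>
        (\<exists>j\<in>I. (x j, y j) \<in> parcs (X j) \<and> (\<forall>l\<in>I - {j}. x l = y l))"
      using UV unfolding P_def cart_prod_def by auto
    also have "\<dots> \<longleftrightarrow> (x, y) \<in> ?R"
      unfolding cart_prod_def induced_on_def by (auto dest: PiE_mem)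
    finally show "(x, y) \<in> ?L \<longleftrightarrow> (x, y) \<in> ?R" .
  qed
  then have box: "induced_on P (\<Pi>\<^sub>E j\<in>I. U j) = cart_prod I ?Y"
    by (simp add: induced_on_def cart_prod_def)
  have B: "pair_graph (cart_prod I ?Y)" by (rule pair_graph_cart_prod[OF finite_I Y])
  have Q: "pair_graph (cart_prod (I - {i}) ?Y)"
    using finite_I Y by (intro pair_graph_cart_prod) auto
  have "graph_isomorphism (\<lambda>f. (restrict f (I - {i}), f i))
      (cart_prod (insert i (I - {i})) ?Y) (cart_prod (I - {i}) ?Y \<box> ?Y i)"
    using Y i by (intro cart_prod_insert) auto
  moreover have "insert i (I - {i}) = I" using i by blast
  ultimately have "graph_isomorphism (prod.swap \<circ> (\<lambda>f. (restrict f (I - {i}), f i)))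
      (cart_prod I ?Y) (?Y i \<box> cart_prod (I - {i}) ?Y)"
    using graph_isomorphism_comp[OF _ box_product_commute] by simp
  then show ?thesis
    unfolding box by (rule is_factor_isoI[OF B Y[OF i] Q])
qed

text \<open>
  A convex set \<open>W\<close> is a box, and the layer through one of its vertices meets it in a copy of the
  \<open>i\<close>-th side.
\<close>

lemma is_factor_layer_Int_convex:
  assumes W: "geodesically_convex P W" and a: "a \<in> W" and i: "i \<in> I"
  shows "is_factor (induced_on P (W \<inter> layer i a)) (induced_on P W)"
proof -
  define U where "U j = (\<lambda>x. x j) ` W" for j
  have WV: "W \<subseteq> pverts P" using W by (simp add: geodesically_convex_def)
  then have aV: "a \<in> pverts P" using a by blast
  have U: "U j \<subseteq> pverts (X j)" if "j \<in> I" for j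
    using WV coord that by (auto simp: U_def)
  have box: "W = (\<Pi>\<^sub>E j\<in>I. U j)" using geodesically_convex_eq_box[OF W a] by (simp add: U_def)
  have "a(i := u) \<in> W" if "u \<in> U i" for u
    using geodesically_convex_exchange[OF W a _ i] that by (auto simp: U_def)
  moreover have "x i \<in> U i" if "x \<in> W" for x
    using that by (auto simp: U_def)
  ultimately have "W \<inter> layer i a = (\<lambda>u. a(i := u)) ` U i"
    unfolding layer_eq_fibre[OF aV i] using U[OF i] by fastforce
  then have iso: "graph_isomorphism (\<lambda>u. a(i := u)) (induced_on (X i) (U i)) (induced_on P (W \<inter> layer i a))"
    using fibre_isomorphism[OF aV i U[OF i]] by simp
  have "W \<inter> layer i a \<subseteq> pverts P" using WV by blast
  moreover have "is_factor (induced_on (X i) (U i)) (induced_on P W)"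
    unfolding box by (rule is_factor_of_box[OF U i])
  ultimately show ?thesis
    using is_factor_iso[OF pair_graph_induced_on[OF pair_graph_P WV]
        pair_graph_induced_on[OF factor[OF i] U[OF i]] pair_graph_induced_on[OF pair_graph_P] iso]
    by simp
qed


section \<open>Automorphisms preserve the directions of arcs\<close>

text \<open>
  This is where relative primality enters. The intersection is a side of the box \<open>\<phi> ` layer i a\<close>,
  a copy of \<open>X i\<close>. Up to \<open>\<phi>\<close> it is also the set \<open>\<psi> ` layer j (\<phi> a) \<inter> layer i a\<close> for the
  inverse \<open>\<psi>\<close> of \<open>\<phi>\<close>, which is a side of the box \<open>\<psi> ` layer j (\<phi> a)\<close>, a copy of \<open>X j\<close>. So it
  induces a common factor of \<open>X i\<close> and \<open>X j\<close>.
\<close>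

lemma no_arc_in_crossing_layers:
  assumes \<phi>: "\<phi> \<in> Aut P" and a: "a \<in> pverts P" and ij: "i \<in> I" "j \<in> I"
    and prime: "relatively_prime (X i) (X j)"
  shows "\<not> nontrivial (induced_on P (\<phi> ` layer i a \<inter> layer j (\<phi> a)))"
proof -
  let ?A = "layer i a" and ?B = "layer j (\<phi> a)"
  define \<psi> where "\<psi> = inv_into (pverts P) \<phi>"
  have iso: "graph_isomorphism \<phi> P P" using \<phi> by (simp add: Aut_def)
  have iso': "graph_isomorphism \<psi> P P" unfolding \<psi>_def by (rule graph_isomorphism_inv[OF iso])
  have bij: "bij_betw \<phi> (pverts P) (pverts P)" using iso by (simp add: graph_isomorphism_def)
  have \<phi>a: "\<phi> a \<in> pverts P" using bij a by (rule bij_betw_apply)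
  have \<psi>\<phi>: "\<psi> (\<phi> x) = x" and \<phi>\<psi>: "\<phi> (\<psi> x) = x" if "x \<in> pverts P" for x
    unfolding \<psi>_def using bij that by (simp_all add: bij_betw_inv_into_left bij_betw_inv_into_right)
  have AV: "?A \<subseteq> pverts P" and BV: "?B \<subseteq> pverts P" by (auto simp: layer_def)
  have aA: "a \<in> ?A" and aB: "\<phi> a \<in> ?B" using a \<phi>a by (auto simp: layer_def)
  have \<phi>A: "\<phi> ` ?A \<subseteq> pverts P" using AV bij_betw_imp_surj_on[OF bij] by blast
  have \<psi>B: "\<psi> ` ?B \<subseteq> pverts P" using BV iso' by (auto simp: graph_isomorphism_def bij_betw_def)
  have conv: "geodesically_convex P (\<phi> ` ?A)" "geodesically_convex P (\<psi> ` ?B)"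
    using geodesically_convex_isomorphism pair_graph_P iso iso' geodesically_convex_layer by blast+
  have pg: "pair_graph (induced_on P W)" if "W \<subseteq> pverts P" for W
    by (rule pair_graph_induced_on[OF pair_graph_P that])

  have "is_factor (induced_on P (\<phi> ` ?A \<inter> ?B)) (induced_on P (\<phi> ` ?A))"
    using conv(1) aA ij by (intro is_factor_layer_Int_convex) auto
  moreover obtain g where "graph_isomorphism g (X i) (induced_on P ?A)"
    using layer_isomorphic_factor[OF a ij(1)] .
  then have "graph_isomorphism (\<phi> \<circ> g) (X i) (induced_on P (\<phi> ` ?A))"
    using graph_isomorphism_induced_on[OF iso AV] by (rule graph_isomorphism_comp)
  ultimately have 1: "is_factor (induced_on P (\<phi> ` ?A \<inter> ?B)) (X i)"
    using is_factor_iso_left[OF factor[OF ij(1)] pg[OF \<phi>A] pg[OF le_infI1[OF \<phi>A]]] by blast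

  have "a \<in> \<psi> ` ?B" using aB \<psi>\<phi>[OF a] by force
  then have "is_factor (induced_on P (\<psi> ` ?B \<inter> ?A)) (induced_on P (\<psi> ` ?B))"
    using conv(2) ij by (intro is_factor_layer_Int_convex) auto
  moreover obtain h where "graph_isomorphism h (X j) (induced_on P ?B)"
    using layer_isomorphic_factor[OF \<phi>a ij(2)] .
  then have "graph_isomorphism (\<psi> \<circ> h) (X j) (induced_on P (\<psi> ` ?B))"
    using graph_isomorphism_induced_on[OF iso' BV] by (rule graph_isomorphism_comp)
  ultimately have 2: "is_factor (induced_on P (\<psi> ` ?B \<inter> ?A)) (X j)"
    using is_factor_iso_left[OF factor[OF ij(2)] pg[OF \<psi>B] pg[OF le_infI1[OF \<psi>B]]] by blast

  have "\<phi> ` (\<psi> ` ?B \<inter> ?A) = \<phi> ` ?A \<inter> ?B"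
  proof
    show "\<phi> ` (\<psi> ` ?B \<inter> ?A) \<subseteq> \<phi> ` ?A \<inter> ?B" using \<phi>\<psi> BV by force
    show "\<phi> ` ?A \<inter> ?B \<subseteq> \<phi> ` (\<psi> ` ?B \<inter> ?A)"
    proof
      fix y assume y: "y \<in> \<phi> ` ?A \<inter> ?B"
      then obtain x where x: "x \<in> ?A" "y = \<phi> x" by blast
      then have "x = \<psi> y" using \<psi>\<phi> AV by auto
      then show "y \<in> \<phi> ` (\<psi> ` ?B \<inter> ?A)" using x y by blast
    qed
  qed
  then have "graph_isomorphism \<phi> (induced_on P (\<psi> ` ?B \<inter> ?A)) (induced_on P (\<phi> ` ?A \<inter> ?B))"
    using graph_isomorphism_induced_on[OF iso, of "\<psi> ` ?B \<inter> ?A"] AV by auto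
  then have "is_factor (induced_on P (\<phi> ` ?A \<inter> ?B)) (X j)"
    using is_factor_iso[OF factor[OF ij(2)] pg[OF le_infI1[OF \<psi>B]] pg[OF le_infI1[OF \<phi>A]] _ 2] by blast
  then show ?thesis
    using not_relatively_primeI[OF factor[OF ij(1)] factor[OF ij(2)] pg[OF le_infI1[OF \<phi>A]] _ 1] prime by blast
qed

end

locale prime_factors = connected_factors I X for I :: "'i set" and X :: "'i \<Rightarrow> 'a pair_pre_digraph" +
  assumes relatively_prime:
    "\<And>i j. i \<in> I \<Longrightarrow> j \<in> I \<Longrightarrow> i \<noteq> j \<Longrightarrow> relatively_prime (X i) (X j)"
begin

text \<open>
  The ends of the image arc lie in the image of the \<open>i\<close>-layer through \<open>x\<close> and in the \<open>j\<close>-layer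
  through \<open>\<phi> x\<close>, where \<open>j\<close> is the direction of the image arc; so \<open>j \<noteq> i\<close> is impossible.
\<close>

lemma Aut_arc_direction:
  assumes \<phi>: "\<phi> \<in> Aut P" and x: "x \<in> pverts P" and i: "i \<in> I" and u: "(x i, u) \<in> parcs (X i)"
  shows "\<phi> (x(i := u)) \<in> layer i (\<phi> x)"
proof -
  let ?y = "x(i := u)"
  have iso: "graph_isomorphism \<phi> P P" using \<phi> by (simp add: Aut_def)
  have y: "?y \<in> pverts P" using upd_in[OF x i] arc_vertices[OF i u] by blast
  have V: "\<phi> x \<in> pverts P" "\<phi> ?y \<in> pverts P"
    using iso x y by (auto simp: graph_isomorphism_def bij_betw_def)
  have "(x, ?y) \<in> parcs P" using x i u by (auto simp: arc_P_iff)
  then have arc: "(\<phi> x, \<phi> ?y) \<in> parcs P"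
    using iso x y by (simp add: graph_isomorphism_def)
  then obtain j w where j: "j \<in> I" "\<phi> ?y = (\<phi> x)(j := w)" by (auto simp: arc_P_iff)
  have "x \<in> layer i x" "?y \<in> layer i x" using x y by (auto simp: layer_def)
  moreover have B: "\<phi> x \<in> layer j (\<phi> x)" "\<phi> ?y \<in> layer j (\<phi> x)" using V j by (auto simp: layer_def)
  ultimately have "nontrivial (induced_on P (\<phi> ` layer i x \<inter> layer j (\<phi> x)))"
    using arc by (auto simp: nontrivial_def induced_on_def)
  then have "j = i"
    using no_arc_in_crossing_layers[OF \<phi> x i j(1)] relatively_prime[OF i j(1)] by blast
  then show ?thesis using B by simp
qed

text \<open>
  Connectedness of \<open>X i\<close> extends the statement about arcs to the whole layer.
\<close>

lemma Aut_layer: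
  assumes \<phi>: "\<phi> \<in> Aut P" and x: "x \<in> pverts P" and i: "i \<in> I" and u: "u \<in> pverts (X i)"
  shows "\<phi> (x(i := u)) \<in> layer i (\<phi> x)"
proof -
  have "(x i, u) \<in> (parcs (X i))\<^sup>*"
    using factor_connected[OF i] coord[OF x i] u by (auto simp: connected_graph_def)
  then show ?thesis
  proof (induct rule: rtrancl_induct)
    case base
    show ?case using \<phi> x by (auto simp: layer_def Aut_def graph_isomorphism_def bij_betw_def)
  next
    case (step v w)
    have "\<phi> (x(i := v, i := w)) \<in> layer i (\<phi> (x(i := v)))"
      using upd_in[OF x i] arc_vertices[OF i step(2)] step(2)
      by (intro Aut_arc_direction[OF \<phi> _ i]) auto
    then show ?case unfolding fun_upd_upd by (rule layer_trans) (rule step(3))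
  qed
qed

lemma Aut_upd:
  assumes "\<phi> \<in> Aut P" "x \<in> pverts P" "i \<in> I" "u \<in> pverts (X i)"
  shows "\<phi> (x(i := u)) = (\<phi> x)(i := \<phi> (x(i := u)) i)"
  using Aut_layer[OF assms] assms(1,2)
  by (intro eq_upd) (auto simp: layer_def Aut_def graph_isomorphism_def bij_betw_def)

text \<open>
  The map sends \<open>u\<close> into the \<open>i\<close>-layer through \<open>x\<close>, applies \<open>\<phi>\<close>, and reads off coordinate \<open>i\<close> in
  the \<open>i\<close>-layer through \<open>\<phi> x\<close>. It is injective since all other coordinates of the image are those
  of \<open>\<phi> x\<close>, hence bijective by finiteness, and both layers are induced copies of \<open>X i\<close>.
\<close>

lemma Aut_factor:
  assumes \<phi>: "\<phi> \<in> Aut P" and x: "x \<in> pverts P" and i: "i \<in> I"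
  shows "(\<lambda>u. \<phi> (x(i := u)) i) \<in> Aut (X i)"
proof -
  let ?g = "\<lambda>u. \<phi> (x(i := u)) i"
  have inj\<phi>: "inj_on \<phi> (pverts P)" and V: "\<And>y. y \<in> pverts P \<Longrightarrow> \<phi> y \<in> pverts P"
    using \<phi> by (auto simp: Aut_def graph_isomorphism_def bij_betw_def)
  have upd: "\<phi> (x(i := u)) = (\<phi> x)(i := ?g u)" if "u \<in> pverts (X i)" for u
    by (rule Aut_upd[OF \<phi> x i that])
  have into: "?g u \<in> pverts (X i)" if "u \<in> pverts (X i)" for u
    using coord[OF V[OF upd_in[OF x i that]] i] .
  have inj: "inj_on ?g (pverts (X i))"
  proof (rule inj_onI)
    fix u v assume u: "u \<in> pverts (X i)" and v: "v \<in> pverts (X i)" and g: "?g u = ?g v"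
    then have "\<phi> (x(i := u)) = \<phi> (x(i := v))" using upd by metis
    then have "x(i := u) = x(i := v)"
      using inj\<phi> upd_in[OF x i u] upd_in[OF x i v] by (metis inj_onD)
    then show "u = v" by (rule fun_upd_eqD)
  qed
  moreover have "?g ` pverts (X i) = pverts (X i)"
    using into inj factor[OF i] by (intro endo_inj_surj) (auto simp: pair_graph_iff)
  moreover have "(u, v) \<in> parcs (X i) \<longleftrightarrow> (?g u, ?g v) \<in> parcs (X i)"
    if u: "u \<in> pverts (X i)" and v: "v \<in> pverts (X i)" for u v
  proof -
    have "(u, v) \<in> parcs (X i) \<longleftrightarrow> (x(i := u), x(i := v)) \<in> parcs P"
      using arc_fibre_iff[OF x i u] by simp
    also have "\<dots> \<longleftrightarrow> (\<phi> (x(i := u)), \<phi> (x(i := v))) \<in> parcs P"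
      using \<phi> upd_in[OF x i u] upd_in[OF x i v] by (simp add: Aut_def graph_isomorphism_def)
    also have "\<dots> \<longleftrightarrow> ((\<phi> x)(i := ?g u), (\<phi> x)(i := ?g v)) \<in> parcs P"
      using upd[OF u] upd[OF v] by simp
    also have "\<dots> \<longleftrightarrow> (?g u, ?g v) \<in> parcs (X i)"
      by (rule arc_fibre_iff[OF V[OF x] i into[OF u]])
    finally show ?thesis .
  qed
  ultimately show ?thesis by (simp add: Aut_def graph_isomorphism_def bij_betw_def)
qed

end


section \<open>The arc orbits and the arc-type of the product\<close>

lemma image_mset_mset_set_Sigma:
  assumes "finite I" "\<And>i. i \<in> I \<Longrightarrow> finite (A i)"
  shows "image_mset g (mset_set (Sigma I A)) = (\<Sum>i\<in>I. image_mset (\<lambda>x. g (i, x)) (mset_set (A i)))"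
  using assms
proof (induct I rule: finite_induct)
  case (insert i I)
  have "Sigma (insert i I) A = Pair i ` A i \<union> Sigma I A" by auto
  moreover have "mset_set (Pair i ` A i \<union> Sigma I A) = mset_set (Pair i ` A i) + mset_set (Sigma I A)"
    using insert by (intro mset_set_Union) auto
  moreover have "mset_set (Pair i ` A i) = image_mset (Pair i) (mset_set (A i))"
    by (simp add: image_mset_mset_set inj_on_def)
  ultimately show ?case
    using insert by (simp add: image_mset.compositionality comp_def)
qed simp

locale transitive_prime_factors = prime_factors I X for I :: "'i set" and X :: "'i \<Rightarrow> 'a pair_pre_digraph" +
  assumes factor_transitive: "\<And>i. i \<in> I \<Longrightarrow> vertex_transitive (X i)"
begin

text \<open>
  The arcs of direction \<open>i\<close> that project into \<open>\<Delta>\<close>; for an arc orbit \<open>\<Delta>\<close> of \<open>X i\<close> this is the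
  corresponding arc orbit of the product.
\<close>

definition arcs_along :: "'i \<Rightarrow> 'a rel \<Rightarrow> ('i \<Rightarrow> 'a) rel" where
  "arcs_along i \<Delta> = {(x, x(i := u)) | x u. x \<in> pverts P \<and> (x i, u) \<in> \<Delta>}"

lemma arcs_alongI: "x \<in> pverts P \<Longrightarrow> (x i, u) \<in> \<Delta> \<Longrightarrow> (x, x(i := u)) \<in> arcs_along i \<Delta>"
  unfolding arcs_along_def by blast

lemma arc_orbit_subset: "i \<in> I \<Longrightarrow> \<Delta> \<in> arc_orbits (X i) \<Longrightarrow> \<Delta> \<subseteq> parcs (X i)"
  using arc_orbits_finite(2)[OF factor] .

lemma arcs_along_converse:
  assumes i: "i \<in> I" and \<Delta>: "\<Delta> \<subseteq> parcs (X i)"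
  shows "(arcs_along i \<Delta>)\<inverse> = arcs_along i (\<Delta>\<inverse>)"
proof -
  have sub: "(arcs_along i \<Delta>)\<inverse> \<subseteq> arcs_along i (\<Delta>\<inverse>)" if \<Delta>: "\<Delta> \<subseteq> parcs (X i)" for \<Delta>
  proof
    fix p assume "p \<in> (arcs_along i \<Delta>)\<inverse>"
    then obtain x u where x: "x \<in> pverts P" "(x i, u) \<in> \<Delta>" "p = (x(i := u), x)"
      by (auto simp: arcs_along_def)
    let ?y = "x(i := u)"
    have "?y \<in> pverts P" using upd_in[OF x(1) i] arc_vertices[OF i] x(2) \<Delta> by blast
    moreover have "(?y i, x i) \<in> \<Delta>\<inverse>" using x(2) by simp
    moreover have "p = (?y, ?y(i := x i))" using x(3) by simp
    ultimately show "p \<in> arcs_along i (\<Delta>\<inverse>)" unfolding arcs_along_def by blast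
  qed
  have "\<Delta>\<inverse> \<subseteq> parcs (X i)" using \<Delta> factor[OF i] by (auto simp: pair_graph_iff dest: symD)
  then show ?thesis using sub[OF \<Delta>] sub[of "\<Delta>\<inverse>"] by auto
qed

lemma arc_in_arcs_along_iff:
  assumes x: "x \<in> pverts P" and i: "i \<in> I" and u: "(x i, u) \<in> parcs (X i)"
  shows "(x, x(i := u)) \<in> arcs_along j \<Delta> \<longleftrightarrow> j = i \<and> (x i, u) \<in> \<Delta>"
proof
  have ne: "x i \<noteq> u" using u factor[OF i] by (auto simp: pair_graph_iff irrefl_def)
  assume "(x, x(i := u)) \<in> arcs_along j \<Delta>"
  then obtain w where w: "(x j, w) \<in> \<Delta>" "x(i := u) = x(j := w)"
    by (auto simp: arcs_along_def)
  have "j = i" using arg_cong[OF w(2), of "\<lambda>f. f i"] ne by (auto split: if_splits)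
  then show "j = i \<and> (x i, u) \<in> \<Delta>" using w(1) arg_cong[OF w(2), of "\<lambda>f. f i"] by simp
next
  assume "j = i \<and> (x i, u) \<in> \<Delta>"
  then show "(x, x(i := u)) \<in> arcs_along j \<Delta>" using x by (auto simp: arcs_along_def)
qed

lemma vertex_with_coordinate:
  assumes "i \<in> I" "u \<in> pverts (X i)"
  obtains x where "x \<in> pverts P" "x i = u"
proof -
  obtain a where "a \<in> pverts P" using pverts_P_nonempty by blast
  then show ?thesis using that[of "a(i := u)"] upd_in[OF _ assms] by simp
qed

text \<open>
  Orbits are non-empty, and a single arc of \<open>arcs_along i \<Delta>\<close> reveals the direction \<open>i\<close>.
\<close>

lemma inj_on_arcs_along:
  "inj_on (\<lambda>(i, \<Delta>). arcs_along i \<Delta>) (SIGMA i:I. arc_orbits (X i))"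
proof -
  have sub: "i = j \<and> \<Delta> \<subseteq> \<Gamma>"
    if i: "i \<in> I" and \<Delta>: "\<Delta> \<in> arc_orbits (X i)" and eq: "arcs_along i \<Delta> = arcs_along j \<Gamma>" for i j \<Delta> \<Gamma>
  proof -
    have arc: "j = i \<and> (u, w) \<in> \<Gamma>" if uw: "(u, w) \<in> \<Delta>" for u w
    proof -
      have a: "(u, w) \<in> parcs (X i)" using arc_orbit_subset[OF i \<Delta>] uw by blast
      obtain x where x: "x \<in> pverts P" "x i = u"
        by (rule vertex_with_coordinate[OF i conjunct1[OF arc_vertices[OF i a]]])
      have "(x, x(i := w)) \<in> arcs_along j \<Gamma>"
        unfolding eq[symmetric] by (rule arcs_alongI[OF x(1)]) (simp add: x(2) uw)
      then show ?thesis unfolding arc_in_arcs_along_iff[OF x(1) i a[folded x(2)]] x(2) .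
    qed
    obtain u w where "\<Delta> = {(f u, f w) | f. f \<in> Aut (X i)}" using \<Delta> unfolding arc_orbits_def by blast
    moreover have "id \<in> Aut (X i)" by (simp add: Aut_def graph_isomorphism_def)
    ultimately have "(id u, id w) \<in> \<Delta>" by blast
    then show ?thesis using arc by (intro conjI subrelI) blast+
  qed
  show ?thesis
  proof (rule inj_onI)
    fix p q assume pq: "p \<in> (SIGMA i:I. arc_orbits (X i))" "q \<in> (SIGMA i:I. arc_orbits (X i))"
      and eq: "(case p of (i, \<Delta>) \<Rightarrow> arcs_along i \<Delta>) = (case q of (i, \<Delta>) \<Rightarrow> arcs_along i \<Delta>)"
    obtain i \<Delta> j \<Gamma> where p: "p = (i, \<Delta>)" and q: "q = (j, \<Gamma>)" by (cases p, cases q)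
    have ij: "i \<in> I" "\<Delta> \<in> arc_orbits (X i)" "j \<in> I" "\<Gamma> \<in> arc_orbits (X j)"
      using pq by (simp_all add: p q)
    have e: "arcs_along i \<Delta> = arcs_along j \<Gamma>" using eq by (simp add: p q)
    show "p = q" using sub[OF ij(1,2) e] sub[OF ij(3,4) e[symmetric]] by (simp add: p q)
  qed
qed

text \<open>
  An automorphism of the product acts on the arc through an automorphism of \<open>X i\<close>. Conversely, an
  automorphism of \<open>X i\<close> that moves the \<open>i\<close>-th coordinates as wanted can be combined with
  automorphisms of the other factors that move the other coordinates of \<open>x\<close> to arbitrary places;
  these exist by vertex-transitivity.
\<close>

lemma arc_orbit_of_arc:
  assumes x: "x \<in> pverts P" and i: "i \<in> I" and u: "u \<in> pverts (X i)"
  shows "{(\<phi> x, \<phi> (x(i := u))) | \<phi>. \<phi> \<in> Aut P} = arcs_along i {(f (x i), f u) | f. f \<in> Aut (X i)}"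
proof
  show "{(\<phi> x, \<phi> (x(i := u))) | \<phi>. \<phi> \<in> Aut P} \<subseteq> arcs_along i {(f (x i), f u) | f. f \<in> Aut (X i)}"
  proof clarify
    fix \<phi> assume \<phi>: "\<phi> \<in> Aut P"
    let ?g = "\<lambda>v. \<phi> (x(i := v)) i"
    have "\<phi> x \<in> pverts P" using \<phi> x by (auto simp: Aut_def graph_isomorphism_def bij_betw_def)
    moreover have "\<phi> (x(i := u)) = (\<phi> x)(i := ?g u)" by (rule Aut_upd[OF \<phi> x i u])
    moreover have "(\<phi> x i, ?g u) \<in> {(f (x i), f u) | f. f \<in> Aut (X i)}"
      using Aut_factor[OF \<phi> x i] by (intro CollectI exI[of _ ?g]) simp
    ultimately show "(\<phi> x, \<phi> (x(i := u))) \<in> arcs_along i {(f (x i), f u) | f. f \<in> Aut (X i)}"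
      unfolding arcs_along_def by blast
  qed
  show "arcs_along i {(f (x i), f u) | f. f \<in> Aut (X i)} \<subseteq> {(\<phi> x, \<phi> (x(i := u))) | \<phi>. \<phi> \<in> Aut P}"
  proof
    fix p assume "p \<in> arcs_along i {(f (x i), f u) | f. f \<in> Aut (X i)}"
    then obtain y f where y: "y \<in> pverts P" and f: "f \<in> Aut (X i)" "y i = f (x i)"
      and p: "p = (y, y(i := f u))"
      unfolding arcs_along_def by blast
    have "\<forall>j\<in>I. \<exists>h. h \<in> Aut (X j) \<and> h (x j) = y j"
      using factor_transitive coord x y unfolding vertex_transitive_def by blast
    then obtain h where h: "\<And>j. j \<in> I \<Longrightarrow> h j \<in> Aut (X j) \<and> h j (x j) = y j" by metis
    define F where "F = h(i := f)"
    have F: "F j \<in> Aut (X j) \<and> F j (x j) = y j" if "j \<in> I" for j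
      using h[OF that] f by (simp add: F_def)
    let ?\<phi> = "\<lambda>x. \<lambda>j\<in>I. F j (x j)"
    have yext: "y \<in> extensional I" using y by (auto simp: pverts_P PiE_iff)
    have "?\<phi> x j = y j \<and> ?\<phi> (x(i := u)) j = (y(i := f u)) j" for j
      using F[of j] yext i by (cases "j \<in> I") (auto simp: extensional_def F_def)
    then have "?\<phi> x = y" "?\<phi> (x(i := u)) = y(i := f u)" by blast+
    moreover have "?\<phi> \<in> Aut P" using F by (intro Aut_P_componentwise) blast
    ultimately have "p = (?\<phi> x, ?\<phi> (x(i := u))) \<and> ?\<phi> \<in> Aut P" using p by (simp only:)
    then show "p \<in> {(\<phi> x, \<phi> (x(i := u))) | \<phi>. \<phi> \<in> Aut P}"
      by (intro CollectI exI[of _ ?\<phi>])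
  qed
qed

lemma arc_orbits_P:
  "arc_orbits P = (\<lambda>(i, \<Delta>). arcs_along i \<Delta>) ` (SIGMA i:I. arc_orbits (X i))"
proof
  show "arc_orbits P \<subseteq> (\<lambda>(i, \<Delta>). arcs_along i \<Delta>) ` (SIGMA i:I. arc_orbits (X i))"
  proof
    fix D assume "D \<in> arc_orbits P"
    then obtain x y where xy: "(x, y) \<in> parcs P" "D = {(\<phi> x, \<phi> y) | \<phi>. \<phi> \<in> Aut P}"
      by (auto simp: arc_orbits_def)
    then obtain i u where i: "x \<in> pverts P" "i \<in> I" "(x i, u) \<in> parcs (X i)" "y = x(i := u)"
      by (auto simp: arc_P_iff)
    have "D = arcs_along i {(f (x i), f u) | f. f \<in> Aut (X i)}"
      using arc_orbit_of_arc[OF i(1,2)] arc_vertices[OF i(2,3)] xy(2) i(4) by simp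
    moreover have "{(f (x i), f u) | f. f \<in> Aut (X i)} \<in> arc_orbits (X i)"
      unfolding arc_orbits_def using i(3) by blast
    ultimately show "D \<in> (\<lambda>(i, \<Delta>). arcs_along i \<Delta>) ` (SIGMA i:I. arc_orbits (X i))"
      using i(2) by force
  qed
  show "(\<lambda>(i, \<Delta>). arcs_along i \<Delta>) ` (SIGMA i:I. arc_orbits (X i)) \<subseteq> arc_orbits P"
  proof clarify
    fix i \<Delta> assume i: "i \<in> I" and "\<Delta> \<in> arc_orbits (X i)"
    then obtain u w where uw: "(u, w) \<in> parcs (X i)" "\<Delta> = {(f u, f w) | f. f \<in> Aut (X i)}"
      by (auto simp: arc_orbits_def)
    obtain x where x: "x \<in> pverts P" "x i = u"
      by (rule vertex_with_coordinate[OF i conjunct1[OF arc_vertices[OF i uw(1)]]])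
    have "arcs_along i \<Delta> = {(\<phi> x, \<phi> (x(i := w))) | \<phi>. \<phi> \<in> Aut P}"
      using arc_orbit_of_arc[OF x(1) i] arc_vertices[OF i uw(1)] uw(2) x(2) by simp
    moreover have "(x, x(i := w)) \<in> parcs P" unfolding arc_P_iff using x i uw(1) by blast
    ultimately show "arcs_along i \<Delta> \<in> arc_orbits P" unfolding arc_orbits_def by blast
  qed
qed

lemma card_out_arcs_along:
  assumes v: "v \<in> pverts P" and i: "i \<in> I" and \<Delta>: "\<Delta> \<subseteq> parcs (X i)"
  shows "card (out_arcs P v \<inter> arcs_along i \<Delta>) = card (out_arcs (X i) (v i) \<inter> \<Delta>)"
proof -
  have "arcs_along i \<Delta> \<subseteq> parcs P"
    using \<Delta> i unfolding arcs_along_def by (clarsimp simp: arc_P_iff) blast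
  then have "out_arcs P v \<inter> arcs_along i \<Delta> = {(v, v(i := u)) | u. (v i, u) \<in> \<Delta>}"
    using v by (auto simp: out_arcs_def arcs_along_def)
  also have "\<dots> = (\<lambda>(_, u). (v, v(i := u))) ` (out_arcs (X i) (v i) \<inter> \<Delta>)"
    using \<Delta> by (force simp: out_arcs_def)
  also have "card \<dots> = card (out_arcs (X i) (v i) \<inter> \<Delta>)"
    by (rule card_image) (auto intro!: inj_onI simp: out_arcs_def dest: fun_upd_eqD)
  finally show ?thesis .
qed

text \<open>
  Representatives of the non-self-paired orbits are chosen in every factor and transported to the
  product. Both multisets are then images of disjoint unions over the factors.
\<close>

lemma has_arc_type_P:
  assumes \<tau>: "\<And>i. i \<in> I \<Longrightarrow> has_arc_type (X i) (\<tau> i)"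
  shows "has_arc_type P (\<Sum>i\<in>I. \<tau> i)"
proof -
  let ?L = "\<lambda>(i, \<Delta>). arcs_along i \<Delta>" and ?O = "\<lambda>i. arc_orbits (X i)"
  let ?S = "\<lambda>i. {\<Delta> \<in> ?O i. \<Delta>\<inverse> = \<Delta>}" and ?N = "\<lambda>i. {\<Delta> \<in> ?O i. \<Delta>\<inverse> \<noteq> \<Delta>}"
  have "\<forall>i\<in>I. \<exists>R. R \<subseteq> ?N i \<and>
       (\<forall>\<Delta>\<in>?O i. \<Delta>\<inverse> \<noteq> \<Delta> \<longrightarrow> (\<Delta> \<in> R \<longleftrightarrow> \<Delta>\<inverse> \<notin> R)) \<and>
       (\<forall>v\<in>pverts (X i). \<tau> i =
         ({# card (out_arcs (X i) v \<inter> \<Delta>). \<Delta> \<in># mset_set (?S i) #},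
          {# card (out_arcs (X i) v \<inter> \<Delta>). \<Delta> \<in># mset_set R #}))"
    using \<tau> unfolding has_arc_type_def by blast
  from bchoice[OF this] obtain R where choice: "\<forall>i\<in>I. R i \<subseteq> ?N i \<and>
       (\<forall>\<Delta>\<in>?O i. \<Delta>\<inverse> \<noteq> \<Delta> \<longrightarrow> (\<Delta> \<in> R i \<longleftrightarrow> \<Delta>\<inverse> \<notin> R i)) \<and>
       (\<forall>v\<in>pverts (X i). \<tau> i =
         ({# card (out_arcs (X i) v \<inter> \<Delta>). \<Delta> \<in># mset_set (?S i) #},
          {# card (out_arcs (X i) v \<inter> \<Delta>). \<Delta> \<in># mset_set (R i) #}))"
    ..
  have R: "\<And>i. i \<in> I \<Longrightarrow> R i \<subseteq> ?N i"
    and R1: "\<And>i \<Delta>. i \<in> I \<Longrightarrow> \<Delta> \<in> ?O i \<Longrightarrow> \<Delta>\<inverse> \<noteq> \<Delta> \<Longrightarrow> \<Delta> \<in> R i \<longleftrightarrow> \<Delta>\<inverse> \<notin> R i"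
    and R2: "\<And>i v. i \<in> I \<Longrightarrow> v \<in> pverts (X i) \<Longrightarrow> \<tau> i =
         ({# card (out_arcs (X i) v \<inter> \<Delta>). \<Delta> \<in># mset_set (?S i) #},
          {# card (out_arcs (X i) v \<inter> \<Delta>). \<Delta> \<in># mset_set (R i) #})"
    using choice by blast+
  have L_conv: "(arcs_along i \<Delta>)\<inverse> = arcs_along i (\<Delta>\<inverse>)" "\<Delta>\<inverse> \<in> ?O i"
    if "i \<in> I" "\<Delta> \<in> ?O i" for i \<Delta>
    using arcs_along_converse[OF that(1) arc_orbit_subset[OF that]]
      arc_orbits_converse[OF factor[OF that(1)] that(2)] by auto
  have L_inj: "arcs_along i \<Delta> = arcs_along j \<Gamma> \<longleftrightarrow> i = j \<and> \<Delta> = \<Gamma>"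
    if "i \<in> I" "\<Delta> \<in> ?O i" "j \<in> I" "\<Gamma> \<in> ?O j" for i \<Delta> j \<Gamma>
    using inj_onD[OF inj_on_arcs_along, of "(i, \<Delta>)" "(j, \<Gamma>)"] that by auto
  have L_self: "(arcs_along i \<Delta>)\<inverse> = arcs_along i \<Delta> \<longleftrightarrow> \<Delta>\<inverse> = \<Delta>" if "i \<in> I" "\<Delta> \<in> ?O i" for i \<Delta>
    using L_conv[OF that] L_inj[of i "\<Delta>\<inverse>" i \<Delta>] that by simp
  have L_R: "arcs_along i \<Delta> \<in> ?L ` Sigma I R \<longleftrightarrow> \<Delta> \<in> R i" if i: "i \<in> I" and \<Delta>: "\<Delta> \<in> ?O i" for i \<Delta>
  proof
    assume "arcs_along i \<Delta> \<in> ?L ` Sigma I R"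
    then obtain j \<Gamma> where j: "j \<in> I" "\<Gamma> \<in> R j" "arcs_along i \<Delta> = arcs_along j \<Gamma>" by auto
    then show "\<Delta> \<in> R i" using L_inj[OF i \<Delta> j(1), of \<Gamma>] R[OF j(1)] by blast
  qed (use i in force)
  have sum: "{# card (out_arcs P v \<inter> D). D \<in># mset_set (?L ` Sigma I T) #} =
      (\<Sum>i\<in>I. {# card (out_arcs (X i) (v i) \<inter> \<Delta>). \<Delta> \<in># mset_set (T i) #})"
    if v: "v \<in> pverts P" and T: "\<And>i. i \<in> I \<Longrightarrow> T i \<subseteq> ?O i" for v T
  proof -
    have fin: "finite (T i)" if "i \<in> I" for i
      using arc_orbits_finite(1)[OF factor[OF that]] T[OF that] by (rule rev_finite_subset)
    have "inj_on ?L (Sigma I T)" using T by (intro inj_on_subset[OF inj_on_arcs_along] Sigma_mono) auto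
    then have "{# card (out_arcs P v \<inter> D). D \<in># mset_set (?L ` Sigma I T) #} =
        {# card (out_arcs P v \<inter> ?L p). p \<in># mset_set (Sigma I T) #}"
      by (simp add: image_mset_mset_set[symmetric] image_mset.compositionality comp_def)
    also have "\<dots> = (\<Sum>i\<in>I. {# card (out_arcs P v \<inter> arcs_along i \<Delta>). \<Delta> \<in># mset_set (T i) #})"
      by (subst image_mset_mset_set_Sigma[OF finite_I fin]) simp_all
    also have "\<dots> = (\<Sum>i\<in>I. {# card (out_arcs (X i) (v i) \<inter> \<Delta>). \<Delta> \<in># mset_set (T i) #})"
    proof (intro sum.cong refl image_mset_cong)
      fix i \<Delta> assume i: "i \<in> I" and "\<Delta> \<in># mset_set (T i)"
      then have "\<Delta> \<subseteq> parcs (X i)" using fin[OF i] T[OF i] arc_orbit_subset[OF i] by auto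
      then show "card (out_arcs P v \<inter> arcs_along i \<Delta>) = card (out_arcs (X i) (v i) \<inter> \<Delta>)"
        by (rule card_out_arcs_along[OF v i])
    qed
    finally show ?thesis .
  qed
  have self: "{D \<in> arc_orbits P. D\<inverse> = D} = ?L ` Sigma I ?S"
  proof
    show "{D \<in> arc_orbits P. D\<inverse> = D} \<subseteq> ?L ` Sigma I ?S"
    proof
      fix D assume "D \<in> {D \<in> arc_orbits P. D\<inverse> = D}"
      then obtain i \<Delta> where i: "i \<in> I" "\<Delta> \<in> ?O i" and D: "D = arcs_along i \<Delta>" "D\<inverse> = D"
        by (auto simp: arc_orbits_P)
      have "(i, \<Delta>) \<in> Sigma I ?S" using i D L_self[OF i] by simp
      then show "D \<in> ?L ` Sigma I ?S" by (rule rev_image_eqI) (simp add: D(1))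
    qed
    show "?L ` Sigma I ?S \<subseteq> {D \<in> arc_orbits P. D\<inverse> = D}"
    proof
      fix D assume "D \<in> ?L ` Sigma I ?S"
      then obtain i \<Delta> where i: "i \<in> I" "\<Delta> \<in> ?O i" "\<Delta>\<inverse> = \<Delta>" and D: "D = arcs_along i \<Delta>" by auto
      have "D \<in> arc_orbits P" unfolding arc_orbits_P D by (rule image_eqI[of _ _ "(i, \<Delta>)"]) (simp_all add: i)
      moreover have "D\<inverse> = D" using L_self[OF i(1,2)] i(3) by (simp only: D)
      ultimately show "D \<in> {D \<in> arc_orbits P. D\<inverse> = D}" by simp
    qed
  qed
  show ?thesis
    unfolding has_arc_type_def
  proof (intro exI[of _ "?L ` Sigma I R"] conjI ballI impI)
    show "?L ` Sigma I R \<subseteq> {D \<in> arc_orbits P. D\<inverse> \<noteq> D}"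
    proof clarify
      fix i \<Delta> assume i: "i \<in> I" and \<Delta>: "\<Delta> \<in> R i"
      then have "\<Delta> \<in> ?O i" "\<Delta>\<inverse> \<noteq> \<Delta>" using R[OF i] by auto
      then show "arcs_along i \<Delta> \<in> arc_orbits P \<and> (arcs_along i \<Delta>)\<inverse> \<noteq> arcs_along i \<Delta>"
        unfolding arc_orbits_P using i L_self[OF i] by auto
    qed
    fix D assume "D \<in> arc_orbits P" and ns: "D\<inverse> \<noteq> D"
    then obtain i \<Delta> where i: "i \<in> I" and \<Delta>: "\<Delta> \<in> ?O i" and D: "D = arcs_along i \<Delta>"
      by (auto simp: arc_orbits_P)
    have "\<Delta>\<inverse> \<noteq> \<Delta>" using ns L_self[OF i \<Delta>] D by simp
    then show "D \<in> ?L ` Sigma I R \<longleftrightarrow> D\<inverse> \<notin> ?L ` Sigma I R"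
      using R1[OF i \<Delta>] L_R[OF i \<Delta>] L_R[OF i L_conv(2)[OF i \<Delta>]] L_conv(1)[OF i \<Delta>] D by simp
  next
    fix v assume v: "v \<in> pverts P"
    have "(\<Sum>i\<in>I. \<tau> i) = (\<Sum>i\<in>I.
        ({# card (out_arcs (X i) (v i) \<inter> \<Delta>). \<Delta> \<in># mset_set (?S i) #},
         {# card (out_arcs (X i) (v i) \<inter> \<Delta>). \<Delta> \<in># mset_set (R i) #}))"
      using R2 coord[OF v] by (intro sum.cong) auto
    also have "\<dots> = ((\<Sum>i\<in>I. {# card (out_arcs (X i) (v i) \<inter> \<Delta>). \<Delta> \<in># mset_set (?S i) #}),
        (\<Sum>i\<in>I. {# card (out_arcs (X i) (v i) \<inter> \<Delta>). \<Delta> \<in># mset_set (R i) #}))"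
      by (simp add: sum_prod)
    also have "\<dots> = ({# card (out_arcs P v \<inter> D). D \<in># mset_set {D \<in> arc_orbits P. D\<inverse> = D} #},
        {# card (out_arcs P v \<inter> D). D \<in># mset_set (?L ` Sigma I R) #})"
    proof -
      have "R i \<subseteq> ?O i" if "i \<in> I" for i using R[OF that] by blast
      then show ?thesis unfolding self by (subst (1 2) sum[OF v]) auto
    qed
    finally show "(\<Sum>i\<in>I. \<tau> i) =
       ({# card (out_arcs P v \<inter> D). D \<in># mset_set {D \<in> arc_orbits P. D\<inverse> = D} #},
        {# card (out_arcs P v \<inter> D). D \<in># mset_set (?L ` Sigma I R) #})" .
  qed
qed

end

theorem theorem7:
  fixes X :: "nat \<Rightarrow> 'a pair_pre_digraph" and \<tau> :: "nat \<Rightarrow> marked_partition" and k :: nat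
  assumes "k \<ge> 1"
    and "\<And>i. i \<in> {1..k} \<Longrightarrow> pair_graph (X i)"
    and "\<And>i. i \<in> {1..k} \<Longrightarrow> nontrivial (X i)"
    and "\<And>i. i \<in> {1..k} \<Longrightarrow> connected (with_proj (X i))"
    and "\<And>i. i \<in> {1..k} \<Longrightarrow> vertex_transitive (X i)"
    and "\<And>i. i \<in> {1..k} \<Longrightarrow> has_arc_type (X i) (\<tau> i)"
  shows "pair_graph (cart_prod {1..k} X) \<and>
    connected (with_proj (cart_prod {1..k} X)) \<and>
    vertex_transitive (cart_prod {1..k} X) \<and>
    (pairwise (\<lambda>i j. relatively_prime (X i) (X j)) {1..k} \<longrightarrow>
      has_arc_type (cart_prod {1..k} X) (\<Sum>i=1..k. \<tau> i))"
proof -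
  interpret connected_factors "{1..k}" X
    using assms(2,4) by (intro connected_factors.intro) (auto simp: connected_iff)
  have "has_arc_type P (\<Sum>i=1..k. \<tau> i)"
    if "pairwise (\<lambda>i j. relatively_prime (X i) (X j)) {1..k}"
  proof -
    interpret transitive_prime_factors "{1..k}" X
      using that assms(5) connected_factors_axioms
      by (intro transitive_prime_factors.intro prime_factors.intro prime_factors_axioms.intro
          transitive_prime_factors_axioms.intro) (auto simp: pairwise_def)
    show ?thesis by (rule has_arc_type_P[OF assms(6)])
  qed
  moreover have "connected (with_proj P)"
    using connected_iff[OF pair_graph_P] connected_graph_P by blast
  ultimately show ?thesis
    using pair_graph_P vertex_transitive_P[OF assms(5)] unfolding P_def by blast
qed

end
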